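(* Let $X\subseteq\mathbb{R}^n$ be nonempty, closed and convex, and let $F(x)=\mathbb{E}[F(x,\omega)]$. Assume: (A1) $F$ is $L$-Lipschitz continuous and monotone on $\mathbb{R}^n$; (A2) the solution set $X^*$ of VI$(X,F)$ is nonempty and compact and there is $C>0$ with $\|F(x^* )\|\le C$ for all $x^*\in X^*$; (A3) (weak sharpness) there is $\alpha>0$ such that $(x-x^* )^TF(x^* )\ge\alpha\,\mathrm{dist}(x,X^* )$ for all $x\in X$ and $x^*\in X^*$; (A4) the state-dependent noise condition described in the context holds with constants $\nu_1,\nu_2\ge 0$. Consider the sequence generated by the variable sample-size stochastic projected reflected gradient scheme (v-SPRG) $$x_{k+1}=\Pi_X\Big(x_k-\gamma\,\tfrac{1}{N_k}\textstyle\sum_{j=1}^{N_k}F(2x_k-x_{k-1},\omega_{j,k})\Big),\quad k\ge 0,$$ with constant steplength $0<\gamma\le \frac{1}{8\tilde L}$, where $\tilde L^2\triangleq L^2+\frac{10\nu_1^2}{N_0}$, and where $\{N_k\}$ is a non-decreasing sequence of positive integers satisfying $\sum_{k=1}^\infty \frac{1}{N_k}<M$ for some finite $M$. Then for any $x_0\in X$, the sequence $\{x_k\}$ converges almost surely to a (random) point in $X^*$.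
   Context: VI$(X,F)$: find $x^*\in X$ with $F(x^* )^T(x-x^* )\ge0$ for all $x\in X$; $X^*$ is its solution set. $\Pi_X$ is the Euclidean projection onto $X$ and $\mathrm{dist}(x,S)=\inf_{y\in S}\|x-y\|$. The map $F$ is expectation-valued: $F(x)=\mathbb{E}[F(x,\omega)]$ where a stochastic oracle returns samples $F(x,\omega)$; the scheme also uses an initial point $x_{-1}$ (needed for the first reflection $2x_0-x_{-1}$). At iteration $k$ the $N_k$ samples $\omega_{j,k}$ are drawn at the point $y_k=2x_k-x_{k-1}$. Noise condition (A4): letting $\mathcal{F}_k$ denote the history (all iterates and samples) before iteration $k$'s samples are drawn, the sampling error $w=F(y_k,\omega_{j,k})-F(y_k)$ of each sample satisfies $\mathbb{E}[w\mid\mathcal{F}_k]=0$ and $\mathbb{E}[\|w\|^2\mid\mathcal{F}_k]\le\nu_1^2\|y_k\|^2+\nu_2^2$ almost surely, the samples within a batch being independent given the history. *)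

theory Defs
  imports "HOL-Analysis.Analysis" "HOL-Probability.Probability"
begin

definition VI_sol :: "'a::euclidean_space set \<Rightarrow> ('a \<Rightarrow> 'a) \<Rightarrow> 'a set" where
  "VI_sol X F = {xs \<in> X. \<forall>x\<in>X. F xs \<bullet> (x - xs) \<ge> 0}"

definition monotone_op :: "('a::euclidean_space \<Rightarrow> 'a) \<Rightarrow> bool" where
  "monotone_op F \<longleftrightarrow> (\<forall>x y. (F x - F y) \<bullet> (x - y) \<ge> 0)"

text \<open>The v-SPRG iterates, shifted by one: vsprg ... k = x_(k-1),
  so vsprg ... 0 = x_(-1), vsprg ... 1 = x_0 and
  x_(k+1) = Pi_X (x_k - gamma/N_k * sum_(j<N_k) G (2 x_k - x_(k-1)) (xi j k)).
  Here G is the stochastic oracle F(x,omega) and xi j k the j-th sample of iteration k.\<close>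
fun vsprg :: "'a::euclidean_space set \<Rightarrow> ('a \<Rightarrow> 'c \<Rightarrow> 'a) \<Rightarrow> real \<Rightarrow> (nat \<Rightarrow> nat)
      \<Rightarrow> (nat \<Rightarrow> nat \<Rightarrow> 'w \<Rightarrow> 'c) \<Rightarrow> 'a \<Rightarrow> 'a \<Rightarrow> nat \<Rightarrow> 'w \<Rightarrow> 'a" where
  "vsprg X G \<gamma> N \<xi> xm1 x0 0 \<omega> = xm1"
| "vsprg X G \<gamma> N \<xi> xm1 x0 (Suc 0) \<omega> = x0"
| "vsprg X G \<gamma> N \<xi> xm1 x0 (Suc (Suc k)) \<omega> =
     (let xk = vsprg X G \<gamma> N \<xi> xm1 x0 (Suc k) \<omega>;
          xkm1 = vsprg X G \<gamma> N \<xi> xm1 x0 k \<omega>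
      in closest_point X (xk - (\<gamma> / real (N k)) *\<^sub>R
                             (\<Sum>j<N k. G (2 *\<^sub>R xk - xkm1) (\<xi> j k \<omega>))))"

text \<open>The history before the samples of iteration k are drawn: the sigma-algebra
  generated by all samples of iterations i < k (the iterates up to x_k are
  deterministic functions of these and of the deterministic x_(-1), x_0).\<close>
definition hist :: "'w measure \<Rightarrow> 'c measure \<Rightarrow> (nat \<Rightarrow> nat) \<Rightarrow> (nat \<Rightarrow> nat \<Rightarrow> 'w \<Rightarrow> 'c)
      \<Rightarrow> nat \<Rightarrow> 'w measure" where
  "hist M S N \<xi> k = sigma (space M)
     (\<Union>i\<in>{..<k}. \<Union>j\<in>{..<N i}. {\<xi> j i -` B \<inter> space M | B. B \<in> sets S})"

end

(*
  For a fixed solution xs, Malitsky's estimate for the projected reflected gradient step shows that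
  |x_{n+1} - xs|^2 + (1/8)|x_{n+1} - y_n|^2 + 2 gamma F(xs).(x_n - xs) + 4 gamma^2 |w_n|^2, where w_n
  is the averaged sampling error, decreases up to a martingale difference and a multiple of
  |w_{n+1}|^2. Conditional independence within a batch gives the latter a conditional expectation
  of order (1 + |y_{n+1}|^2)/N_{n+1}, which is summable up to a relative error, so the
  Robbins--Siegmund theorem applies: almost surely |x_n - xs| converges and F(xs).(x_n - xs) tends
  to 0. Weak sharpness turns the second limit into dist(x_n, S) -> 0 for the solution set S. Taking
  xs from a countable dense subset of the compact set S, |x_n - xs| converges for all solutions at
  once, in particular for a cluster point of (x_n) in S, and there the limit must be 0.
*)
theory Submission
  imports Defs
begin

text \<open>The noise level at y_n grows with |y_n|^2, and X may be unbounded, so there is no a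
  priori variance bound. Instead |y_{n+1}|^2 is at most a multiple of |x_{n+1} - xs|^2 + |x_{n+1} -
  x_n|^2 + |xs|^2. The first summand becomes the relative error; the second is swallowed by the term
  -(7/8) |x_{n+1} - x_n|^2 of the step estimate, which is what the noise summand in the steplength
  bound pays for. The new error is paired with y_{n+1} - xs, known before the samples are drawn, and
  not with x_{n+2} - xs, which depends on them. The exchange costs squared errors and part of
  |x_{n+2} - y_{n+1}|^2. The projection inequality at x_{n+1} brings in the old error w_n, so its
  square is carried in the Lyapunov function. The left side of the step estimate contains |x_{n+2} -
  y_{n+1}|^2 and the gap F(xs).(x_{n+1} - xs) twice over: one copy enters the next Lyapunov value,
  the other is what gets summed.\<close>

section \<open>Nonnegative almost supermartingales\<close>

text \<open>The betting strategy behind Doob's upcrossing inequality: buy below \<open>a\<close>, sell above \<open>b\<close>.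
  Whether a share is held during step \<open>n\<close> depends on \<open>s\<close> before \<open>n\<close> only, so
  the strategy is predictable.\<close>
fun holding :: "real \<Rightarrow> real \<Rightarrow> (nat \<Rightarrow> real) \<Rightarrow> nat \<Rightarrow> bool" where
  "holding a b s 0 = False"
| "holding a b s (Suc n) = (if holding a b s n then s n \<le> b else s n < a)"

definition upcrossings :: "real \<Rightarrow> real \<Rightarrow> (nat \<Rightarrow> real) \<Rightarrow> nat \<Rightarrow> real" where
  "upcrossings a b s n = (\<Sum>k<n. of_bool (holding a b s k \<and> b < s k))"

text \<open>A share bought below \<open>a\<close> and sold above \<open>b\<close> earns at least
  \<open>b - a\<close>. The induction must also credit an open position with \<open>s n - a\<close>;
  nonnegativity of \<open>s\<close> limits the loss on it to \<open>\<bar>a\<bar>\<close>. The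
  position over the step from \<open>k\<close> to \<open>Suc k\<close> carries the index
  \<open>Suc k\<close> although it is decided at \<open>k\<close>.\<close>

lemma upcrossings_le_gain:
  assumes "a < b" and "\<And>k. 0 \<le> s k"
  shows "(b - a) * upcrossings a b s n
      \<le> \<bar>a\<bar> + (\<Sum>k<n. of_bool (holding a b s (Suc k)) * (s (Suc k) - s k))"
proof -
  have "(b - a) * upcrossings a b s n + (if holding a b s n then s n - a else 0)
      \<le> (\<Sum>k<n. of_bool (holding a b s (Suc k)) * (s (Suc k) - s k))"
  proof (induction n)
    case 0
    then show ?case by (simp add: upcrossings_def)
  next
    case (Suc n)
    then show ?case
      using \<open>a < b\<close> by (auto simp: upcrossings_def algebra_simps split: if_splits)
  qed
  moreover have "- \<bar>a\<bar> \<le> (if holding a b s n then s n - a else 0)"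
    using assms(2)[of n] by auto
  ultimately show ?thesis by linarith
qed

lemma upcrossings_mono: "m \<le> n \<Longrightarrow> upcrossings a b s m \<le> upcrossings a b s n"
  unfolding upcrossings_def by (rule sum_mono2) auto

text \<open>After any visit below \<open>a\<close> a share is held, and the first later time above
  \<open>b\<close> sells it, which raises the count by one; this can be repeated forever.\<close>

lemma upcrossings_unbounded:
  assumes low: "\<exists>\<^sub>F n in sequentially. s n < a" and high: "\<exists>\<^sub>F n in sequentially. b < s n"
  shows "\<exists>n. real m \<le> upcrossings a b s n"
proof (induction m)
  case 0
  have "real 0 \<le> upcrossings a b s 0" by (simp add: upcrossings_def)
  then show ?case by blast
next
  case (Suc m)
  then obtain n where n: "real m \<le> upcrossings a b s n" by blast
  from low obtain k where k: "k \<ge> n" "s k < a" by (auto simp: frequently_sequentially)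
  \<comment> \<open>If no share is held at \<open>k\<close>, it is bought there and held from
    \<open>Suc k\<close> on, hence the two candidates for \<open>k'\<close>.\<close>
  then have "holding a b s k \<or> holding a b s (Suc k)" by auto
  then obtain k' where k': "k' \<ge> n" "holding a b s k'"
    using k by (meson le_SucI)
  define j where "j = (LEAST j. k' \<le> j \<and> b < s j)"
  have "\<exists>j. k' \<le> j \<and> b < s j" using high by (auto simp: frequently_sequentially)
  then have j: "k' \<le> j" "b < s j" unfolding j_def by (metis (mono_tags, lifting) LeastI)+
  have below: "s i \<le> b" if "k' \<le> i" "i < j" for i
    using not_less_Least[of i "\<lambda>j. k' \<le> j \<and> b < s j"] that unfolding j_def by auto
  have "holding a b s i" if "k' \<le> i" "i \<le> j" for i
    using that by (induction i rule: dec_induct) (use k' below in auto)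
  then have "holding a b s j" using j by simp
  then have "upcrossings a b s (Suc j) = upcrossings a b s j + 1"
    using j by (simp add: upcrossings_def)
  moreover have "upcrossings a b s n \<le> upcrossings a b s j"
    using k' j by (intro upcrossings_mono) simp
  ultimately show ?case using n by (intro exI[of _ "Suc j"]) simp
qed

text \<open>Oscillation would leave room for two rationals between lower and upper limit, and
  rational levels keep the exceptional null sets countable later on. Divergence to infinity need not
  cross anything and is excluded by \<open>fin\<close>.\<close>

lemma convergent_if_upcrossings_bounded:
  fixes s :: "nat \<Rightarrow> real"
  assumes nn: "\<And>n. 0 \<le> s n"
    and fin: "\<exists>\<^sub>F n in sequentially. s n < c"
    and up: "\<And>p q :: rat. p < q \<Longrightarrow> \<exists>B. \<forall>n. upcrossings (of_rat p) (of_rat q) s n \<le> B"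
  shows "convergent s"
proof -
  define f where "f = (\<lambda>n. ereal (s n))"
  have "limsup f \<le> liminf f"
  proof (rule ccontr)
    assume "\<not> limsup f \<le> liminf f"
    then have "liminf f < limsup f" by simp
    then obtain p where p: "liminf f < ereal (real_of_rat p)" "ereal (real_of_rat p) < limsup f"
      using ereal_dense3 by blast
    then obtain q where q: "ereal (real_of_rat p) < ereal (real_of_rat q)" "ereal (real_of_rat q) < limsup f"
      using ereal_dense3 by blast
    have "p < q" using q(1) by (simp add: of_rat_less)
    have "\<exists>\<^sub>F n in sequentially. s n < of_rat p"
    proof (rule ccontr)
      assume "\<not> (\<exists>\<^sub>F n in sequentially. s n < of_rat p)"
      then have "\<forall>\<^sub>F n in sequentially. ereal (of_rat p) \<le> f n"
        by (simp add: not_frequently f_def not_less)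
      then have "ereal (of_rat p) \<le> liminf f" by (rule Liminf_bounded)
      then show False using p(1) by simp
    qed
    moreover have "\<exists>\<^sub>F n in sequentially. of_rat q < s n"
    proof (rule ccontr)
      assume "\<not> (\<exists>\<^sub>F n in sequentially. of_rat q < s n)"
      then have "\<forall>\<^sub>F n in sequentially. f n \<le> ereal (of_rat q)"
        by (simp add: not_frequently f_def not_less)
      then have "limsup f \<le> ereal (of_rat q)" by (rule Limsup_bounded)
      then show False using q(2) by simp
    qed
    ultimately have *: "\<exists>n. real m \<le> upcrossings (of_rat p) (of_rat q) s n" for m
      by (rule upcrossings_unbounded)
    obtain B where B: "\<And>n. upcrossings (of_rat p) (of_rat q) s n \<le> B"
      using up[OF \<open>p < q\<close>] by blast
    obtain m :: nat where "B < real m" using reals_Archimedean2 by blast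
    with *[of m] B show False by (meson leD order_trans)
  qed
  then have eq: "limsup f = liminf f"
    using Liminf_le_Limsup[of sequentially f] by (simp add: antisym)
  have lim: "f \<longlonglongrightarrow> liminf f" using eq by (intro Liminf_eq_Limsup) auto
  have "0 \<le> liminf f" by (rule Liminf_bounded) (simp add: f_def nn)
  moreover have "liminf f \<noteq> \<infinity>"
  proof
    assume "liminf f = \<infinity>"
    with lim have "\<forall>\<^sub>F n in sequentially. ereal c < f n"
      by (intro order_tendstoD(1)) auto
    then have "\<forall>\<^sub>F n in sequentially. \<not> s n < c"
      by (rule eventually_mono) (simp add: f_def)
    with fin show False by (simp add: frequently_def)
  qed
  ultimately obtain r where "liminf f = ereal r"
    by (cases "liminf f") auto
  with lim have "s \<longlonglongrightarrow> r" by (simp add: f_def)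
  then show ?thesis by (auto simp: convergent_def)
qed

text \<open>Doob's argument: the position over each step is decided beforehand, so its expected gain
  is at most 0, and the expected number of upcrossings is at most
  \<open>\<bar>a\<bar> / (b - a)\<close> whatever the horizon.\<close>

lemma (in prob_space) supermartingale_upcrossings_bounded:
  fixes W :: "nat \<Rightarrow> 'a \<Rightarrow> real"
  assumes sub: "\<And>n. subalgebra M (H n)" and mono: "\<And>n. sets (H n) \<subseteq> sets (H (Suc n))"
    and meas: "\<And>n. W n \<in> borel_measurable (H n)" and int: "\<And>n. integrable M (W n)"
    and nn: "\<And>n \<omega>. 0 \<le> W n \<omega>"
    and super: "\<And>n A. A \<in> sets (H n) \<Longrightarrow> (LINT \<omega>:A|M. W (Suc n) \<omega>) \<le> (LINT \<omega>:A|M. W n \<omega>)"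
    and "a < b"
  shows "AE \<omega> in M. \<exists>B. \<forall>n. upcrossings a b (\<lambda>k. W k \<omega>) n \<le> B"
proof -
  define h where "h n = {\<omega> \<in> space M. holding a b (\<lambda>k. W k \<omega>) n}" for n
  have sp: "space (H n) = space M" for n using sub[of n] by (simp add: subalgebra_def)
  \<comment> \<open>Predictability: the decision for the step from \<open>n\<close> to
    \<open>Suc n\<close> is an event of \<open>H n\<close>, hence an admissible set in
    \<open>super\<close>.\<close>
  have meas_h: "h (Suc n) \<in> sets (H n)" for n
  proof (induction n)
    case 0
    have "h (Suc 0) = {\<omega> \<in> space (H 0). W 0 \<omega> < a}" by (simp add: h_def sp)
    also have "\<dots> \<in> sets (H 0)" using meas[of 0] by measurable
    finally show ?case .
  next
    case (Suc n)
    then have [measurable]: "h (Suc n) \<in> sets (H (Suc n))" using mono by blast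
    note meas[measurable]
    have "h (Suc (Suc n)) = (h (Suc n) \<inter> {\<omega> \<in> space (H (Suc n)). W (Suc n) \<omega> \<le> b})
        \<union> ({\<omega> \<in> space (H (Suc n)). W (Suc n) \<omega> < a} - h (Suc n))"
      unfolding sp h_def by auto
    also have "\<dots> \<in> sets (H (Suc n))" by measurable
    finally show ?case .
  qed
  have hM: "h n \<in> sets M" for n
  proof (cases n)
    case 0
    then show ?thesis by (simp add: h_def)
  next
    case (Suc m)
    then show ?thesis using meas_h[of m] sub[of m] by (auto simp: subalgebra_def)
  qed
  have WM [measurable]: "W n \<in> borel_measurable M" for n
    using measurable_from_subalg[OF sub meas] .
  define u where "u n \<omega> = upcrossings a b (\<lambda>k. W k \<omega>) n" for n \<omega>
  have u_eq: "u n \<omega> = (\<Sum>k<n. indicator (h k \<inter> {\<omega> \<in> space M. b < W k \<omega>}) \<omega>)" if "\<omega> \<in> space M" for n \<omega>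
    unfolding u_def upcrossings_def using that
    by (intro sum.cong) (auto simp: h_def indicator_def)
  have u_meas [measurable]: "u n \<in> borel_measurable M" for n
  proof -
    note hM[measurable]
    have "(\<lambda>\<omega>. \<Sum>k<n. indicator (h k \<inter> {\<omega> \<in> space M. b < W k \<omega>}) \<omega> :: real) \<in> borel_measurable M"
      by measurable
    then show ?thesis by (subst measurable_cong[OF u_eq])
  qed
  have u_nn: "0 \<le> u n \<omega>" for n \<omega> by (simp add: u_def upcrossings_def sum_nonneg)
  have u_int: "integrable M (u n)" for n
  proof (rule integrable_const_bound[where B = "real n"])
    have "u n \<omega> \<le> (\<Sum>k<n. 1)" for \<omega> unfolding u_def upcrossings_def by (rule sum_mono) auto
    then show "AE \<omega> in M. norm (u n \<omega>) \<le> real n" using u_nn by simp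
  qed simp
  define G where "G n \<omega> = (\<Sum>k<n. indicator (h (Suc k)) \<omega> * (W (Suc k) \<omega> - W k \<omega>))" for n \<omega>
  have G_int1: "integrable M (\<lambda>\<omega>. indicator (h (Suc k)) \<omega> * (W (Suc k) \<omega> - W k \<omega>))" for k
    using integrable_mult_indicator[OF hM, of "\<lambda>\<omega>. W (Suc k) \<omega> - W k \<omega>" "Suc k"] int by simp
  have G_int: "integrable M (G n)" for n
    unfolding G_def by (intro Bochner_Integration.integrable_sum G_int1)
  have G_le: "(\<integral>\<omega>. G n \<omega> \<partial>M) \<le> 0" for n
  proof -
    have "(\<integral>\<omega>. indicator (h (Suc k)) \<omega> * (W (Suc k) \<omega> - W k \<omega>) \<partial>M) \<le> 0" for k
    proof -
      have i: "integrable M (\<lambda>\<omega>. indicator (h (Suc k)) \<omega> * W m \<omega>)" for m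
        using integrable_mult_indicator[OF hM int, of "Suc k" m] by simp
      show ?thesis
        using super[OF meas_h, of k] i
        by (simp add: right_diff_distrib set_lebesgue_integral_def)
    qed
    then show ?thesis unfolding G_def
      by (subst Bochner_Integration.integral_sum) (auto intro: G_int1 sum_nonpos)
  qed
  have bound: "(\<integral>\<omega>. u n \<omega> \<partial>M) \<le> \<bar>a\<bar> / (b - a)" for n
  proof -
    have "(b - a) * (\<integral>\<omega>. u n \<omega> \<partial>M) = (\<integral>\<omega>. (b - a) * u n \<omega> \<partial>M)" by simp
    also have "\<dots> \<le> (\<integral>\<omega>. \<bar>a\<bar> + G n \<omega> \<partial>M)"
    proof (rule integral_mono)
      fix \<omega> assume "\<omega> \<in> space M"
      then have "G n \<omega> = (\<Sum>k<n. of_bool (holding a b (\<lambda>k. W k \<omega>) (Suc k)) * (W (Suc k) \<omega> - W k \<omega>))"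
        unfolding G_def by (intro sum.cong) (auto simp: h_def)
      then show "(b - a) * u n \<omega> \<le> \<bar>a\<bar> + G n \<omega>"
        using upcrossings_le_gain[OF \<open>a < b\<close>, of "\<lambda>k. W k \<omega>" n] nn by (simp add: u_def)
    qed (use u_int G_int in auto)
    also have "\<dots> = \<bar>a\<bar> + (\<integral>\<omega>. G n \<omega> \<partial>M)" using G_int by (simp add: prob_space)
    also have "\<dots> \<le> \<bar>a\<bar>" using G_le[of n] by simp
    finally show ?thesis using \<open>a < b\<close> by (simp add: field_simps)
  qed
  have "(\<integral>\<^sup>+\<omega>. (SUP n. ennreal (u n \<omega>)) \<partial>M) = (SUP n. \<integral>\<^sup>+\<omega>. ennreal (u n \<omega>) \<partial>M)"
  proof (rule nn_integral_monotone_convergence_SUP)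
    show "incseq (\<lambda>n \<omega>. ennreal (u n \<omega>))"
      by (auto simp: incseq_def le_fun_def u_def intro!: ennreal_leI upcrossings_mono)
  qed simp
  also have "\<dots> \<le> ennreal (\<bar>a\<bar> / (b - a))"
    by (rule SUP_least) (use bound u_int u_nn in \<open>simp add: nn_integral_eq_integral ennreal_leI\<close>)
  finally have "(\<integral>\<^sup>+\<omega>. (SUP n. ennreal (u n \<omega>)) \<partial>M) \<noteq> \<infinity>"
    by (auto simp: top_unique)
  then have "AE \<omega> in M. (SUP n. ennreal (u n \<omega>)) \<noteq> \<infinity>"
    by (intro nn_integral_PInf_AE) auto
  then show ?thesis
  proof eventually_elim
    case (elim \<omega>)
    then obtain r where r: "0 \<le> r" "(SUP n. ennreal (u n \<omega>)) = ennreal r"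
      by (cases "SUP n. ennreal (u n \<omega>)") auto
    have "u n \<omega> \<le> r" for n
    proof -
      have "ennreal (u n \<omega>) \<le> ennreal r" unfolding r(2)[symmetric] by (rule SUP_upper) simp
      then show ?thesis using r(1) by simp
    qed
    then show ?case by (auto simp: u_def)
  qed
qed

text \<open>Expectations do not increase, so Fatou makes the lower limit almost surely finite; with
  the upcrossing bounds for the countably many rational pairs, only convergence remains.\<close>

theorem (in prob_space) nonneg_supermartingale_convergent:
  fixes W :: "nat \<Rightarrow> 'a \<Rightarrow> real"
  assumes sub: "\<And>n. subalgebra M (H n)" and mono: "\<And>n. sets (H n) \<subseteq> sets (H (Suc n))"
    and meas: "\<And>n. W n \<in> borel_measurable (H n)" and int: "\<And>n. integrable M (W n)"
    and nn: "\<And>n \<omega>. 0 \<le> W n \<omega>"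
    and super: "\<And>n A. A \<in> sets (H n) \<Longrightarrow> (LINT \<omega>:A|M. W (Suc n) \<omega>) \<le> (LINT \<omega>:A|M. W n \<omega>)"
  shows "AE \<omega> in M. convergent (\<lambda>n. W n \<omega>)"
proof -
  have WM [measurable]: "W n \<in> borel_measurable M" for n
    using measurable_from_subalg[OF sub meas] .
  have up: "AE \<omega> in M. \<forall>p q :: rat. p < q \<longrightarrow>
      (\<exists>B. \<forall>n. upcrossings (of_rat p) (of_rat q) (\<lambda>k. W k \<omega>) n \<le> B)"
    unfolding AE_all_countable
    using supermartingale_upcrossings_bounded[where H = H and W = W, OF sub mono meas int nn super]
    by (auto simp: of_rat_less)
  have dec: "(\<integral>\<omega>. W n \<omega> \<partial>M) \<le> (\<integral>\<omega>. W 0 \<omega> \<partial>M)" for n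
  proof (induction n)
    case (Suc n)
    have "space M \<in> sets (H n)"
      using sets.top[of "H n"] sub[of n] unfolding subalgebra_def by metis
    from super[OF this] Suc show ?case by (simp add: set_integral_space int)
  qed simp
  have "(\<integral>\<^sup>+\<omega>. liminf (\<lambda>n. ennreal (W n \<omega>)) \<partial>M) \<le> liminf (\<lambda>n. \<integral>\<^sup>+\<omega>. ennreal (W n \<omega>) \<partial>M)"
    by (rule nn_integral_liminf) simp
  also have "\<dots> \<le> liminf (\<lambda>n. ennreal (\<integral>\<omega>. W 0 \<omega> \<partial>M))"
    by (rule Liminf_mono) (use dec nn int in \<open>simp add: nn_integral_eq_integral ennreal_leI\<close>)
  also have "\<dots> = ennreal (\<integral>\<omega>. W 0 \<omega> \<partial>M)" by (simp add: Liminf_const)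
  finally have "(\<integral>\<^sup>+\<omega>. liminf (\<lambda>n. ennreal (W n \<omega>)) \<partial>M) \<noteq> \<infinity>"
    by (auto simp: top_unique)
  then have "AE \<omega> in M. liminf (\<lambda>n. ennreal (W n \<omega>)) \<noteq> \<infinity>"
    by (intro nn_integral_PInf_AE) auto
  with up show ?thesis
  proof eventually_elim
    case (elim \<omega>)
    then obtain r where r: "0 \<le> r" "liminf (\<lambda>n. ennreal (W n \<omega>)) = ennreal r"
      by (cases "liminf (\<lambda>n. ennreal (W n \<omega>))") auto
    have "\<exists>\<^sub>F n in sequentially. W n \<omega> < r + 1"
    proof (rule ccontr)
      assume "\<not> (\<exists>\<^sub>F n in sequentially. W n \<omega> < r + 1)"
      then have "\<forall>\<^sub>F n in sequentially. ennreal (r + 1) \<le> ennreal (W n \<omega>)"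
        by (auto simp: not_frequently not_less intro: ennreal_leI elim: eventually_mono)
      then have "ennreal (r + 1) \<le> ennreal r" unfolding r(2)[symmetric] by (rule Liminf_bounded)
      then show False using r(1) by simp
    qed
    then show ?case
      using elim(1) nn by (intro convergent_if_upcrossings_bounded) auto
  qed
qed


text \<open>Discounting by \<open>exp (- (b 0 + \<dots> + b (n - 1)))\<close> and compensating with the tail of \<open>c\<close>
  turns \<open>V\<close> plus the accumulated \<open>d\<close> into a nonnegative supermartingale.\<close>
theorem (in prob_space) Robbins_Siegmund:
  fixes V d :: "nat \<Rightarrow> 'a \<Rightarrow> real" and b c :: "nat \<Rightarrow> real"
  assumes sub: "\<And>n. subalgebra M (H n)" and mono: "\<And>n. sets (H n) \<subseteq> sets (H (Suc n))"
    and V_meas: "\<And>n. V n \<in> borel_measurable (H n)" and V_int: "\<And>n. integrable M (V n)"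
    and V_nn: "\<And>n \<omega>. 0 \<le> V n \<omega>"
    and d_meas: "\<And>n. d n \<in> borel_measurable (H (Suc n))" and d_int: "\<And>n. integrable M (d n)"
    and d_nn: "\<And>n \<omega>. 0 \<le> d n \<omega>"
    and b_nn: "\<And>n. 0 \<le> b n" and b_sum: "summable b"
    and c_nn: "\<And>n. 0 \<le> c n" and c_sum: "summable c"
    and step: "\<And>n A. A \<in> sets (H n) \<Longrightarrow>
      (LINT \<omega>:A|M. V (Suc n) \<omega> + d n \<omega>) \<le> (LINT \<omega>:A|M. (1 + b n) * V n \<omega> + c n)"
  shows "AE \<omega> in M. convergent (\<lambda>n. V n \<omega>) \<and> summable (\<lambda>n. d n \<omega>)"
proof -
  \<comment> \<open>The discount: \<open>exp (b n) \<ge> 1 + b n\<close> yields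
    \<open>P (Suc n) * (1 + b n) \<le> P n\<close>. It stays above \<open>exp (- suminf b)\<close>,
    so it can be divided out at the end. The inequality of step \<open>n\<close> is multiplied by
    \<open>P (Suc n)\<close>, which fixes the weights of \<open>d n\<close> and
    \<open>c n\<close>.\<close>
  define P where "P n = exp (- (\<Sum>i<n. b i))" for n
  define D where "D n \<omega> = (\<Sum>i<n. P (Suc i) * d i \<omega>)" for n \<omega>
  \<comment> \<open>The whole of \<open>suminf c\<close> is set aside in advance; since
    \<open>P \<le> 1\<close>, the discounted costs never exceed it.\<close>
  define E where "E n = suminf c - (\<Sum>i<n. P (Suc i) * c i)" for n
  define W where "W n \<omega> = P n * V n \<omega> + D n \<omega> + E n" for n \<omega>
  have P_pos: "0 < P n" for n by (simp add: P_def)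
  have P_le: "P n \<le> 1" for n by (simp add: P_def b_nn sum_nonneg)
  have P_step: "P (Suc n) * (1 + b n) \<le> P n" for n
  proof -
    have "P n = P (Suc n) * exp (b n)" by (simp add: P_def flip: exp_add)
    then show ?thesis using exp_ge_add_one_self[of "b n"] P_pos[of "Suc n"] by simp
  qed
  have P_lim: "P \<longlonglongrightarrow> exp (- suminf b)"
    unfolding P_def using summable_LIMSEQ[OF b_sum] by (intro tendsto_intros)
  have P_ge: "exp (- suminf b) \<le> P n" for n
    unfolding P_def using sum_le_suminf[OF b_sum, of "{..<n}"] b_nn by simp
  have D_nn: "0 \<le> D n \<omega>" for n \<omega>
    unfolding D_def by (intro sum_nonneg mult_nonneg_nonneg d_nn less_imp_le[OF P_pos])
  have Pc: "P (Suc i) * c i \<le> c i" "0 \<le> P (Suc i) * c i" for i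
    using mult_right_mono[OF P_le c_nn, of "Suc i" i] c_nn P_pos[of "Suc i"] by auto
  have E_nn: "0 \<le> E n" for n
  proof -
    have "(\<Sum>i<n. P (Suc i) * c i) \<le> (\<Sum>i<n. c i)" by (intro sum_mono Pc)
    also have "\<dots> \<le> suminf c" by (rule sum_le_suminf[OF c_sum]) (auto intro: c_nn)
    finally show ?thesis by (simp add: E_def)
  qed
  have "summable (\<lambda>i. P (Suc i) * c i)"
    by (rule summable_comparison_test'[OF c_sum]) (use Pc in auto)
  then have E_lim: "convergent E"
    unfolding E_def convergent_def
    using tendsto_diff[OF tendsto_const summable_LIMSEQ] by blast
  have meas_mono: "f \<in> borel_measurable (H n)" if "f \<in> borel_measurable (H m)" "m \<le> n"
    for f :: "'a \<Rightarrow> real" and m n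
  proof -
    have "sets (H m) \<subseteq> sets (H n)" by (rule lift_Suc_mono_le[of "\<lambda>k. sets (H k)", OF mono \<open>m \<le> n\<close>])
    moreover have "space (H m) = space (H n)" using sub by (simp add: subalgebra_def)
    ultimately show ?thesis using that(1) by (auto simp: measurable_def)
  qed
  have "AE \<omega> in M. convergent (\<lambda>n. W n \<omega>)"
  proof (rule nonneg_supermartingale_convergent[where H = H])
    show "W n \<in> borel_measurable (H n)" for n
      unfolding W_def D_def
      by (intro borel_measurable_add borel_measurable_times borel_measurable_const V_meas
          borel_measurable_sum meas_mono[OF d_meas]) simp
    show W_int: "integrable M (W n)" for n
      unfolding W_def D_def using V_int d_int by simp
    show "0 \<le> W n \<omega>" for n \<omega>
      unfolding W_def using P_pos[of n] V_nn[of n \<omega>] D_nn[of n \<omega>] E_nn[of n] by simp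
    fix n A assume A: "A \<in> sets (H n)"
    then have AM: "A \<in> sets M" using sub[of n] by (auto simp: subalgebra_def)
    have si: "set_integrable M A f" if "integrable M f" for f :: "'a \<Rightarrow> real"
      using integrable_mult_indicator[OF AM that] by (simp add: set_integrable_def)
    have "(LINT \<omega>:A|M. W (Suc n) \<omega>) - (LINT \<omega>:A|M. W n \<omega>) = (LINT \<omega>:A|M. W (Suc n) \<omega> - W n \<omega>)"
      using W_int by (simp add: set_integral_diff si)
    also have "\<dots> \<le> (LINT \<omega>:A|M. P (Suc n) * ((V (Suc n) \<omega> + d n \<omega>) - ((1 + b n) * V n \<omega> + c n)))"
    proof (rule set_integral_mono)
      fix \<omega>
      have "P (Suc n) * (1 + b n) * V n \<omega> \<le> P n * V n \<omega>"
        by (rule mult_right_mono[OF P_step V_nn])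
      then show "W (Suc n) \<omega> - W n \<omega>
          \<le> P (Suc n) * ((V (Suc n) \<omega> + d n \<omega>) - ((1 + b n) * V n \<omega> + c n))"
        by (simp add: W_def D_def E_def algebra_simps)
    qed (intro si Bochner_Integration.integrable_diff integrable_mult_right
        Bochner_Integration.integrable_add W_int V_int d_int integrable_const)+
    also have "\<dots> = P (Suc n) * ((LINT \<omega>:A|M. V (Suc n) \<omega> + d n \<omega>) - (LINT \<omega>:A|M. (1 + b n) * V n \<omega> + c n))"
      by (subst set_integral_diff(2)[symmetric])
        (auto intro!: si Bochner_Integration.integrable_add V_int d_int)
    also have "\<dots> \<le> 0" using step[OF A] P_pos[of "Suc n"] by (simp add: mult_le_0_iff)
    finally show "(LINT \<omega>:A|M. W (Suc n) \<omega>) \<le> (LINT \<omega>:A|M. W n \<omega>)" by simp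
  qed (fact sub mono)+
  then show ?thesis
  proof eventually_elim
    case (elim \<omega>)
    then obtain K where K: "\<And>n. \<bar>W n \<omega>\<bar> \<le> K"
      using convergent_imp_Bseq[THEN BseqD] by fastforce
    have D_le: "D n \<omega> \<le> K" for n
      using K[of n] P_pos[of n] V_nn[of n \<omega>] E_nn[of n] mult_nonneg_nonneg[of "P n" "V n \<omega>"]
      unfolding W_def by linarith
    have sD: "summable (\<lambda>i. P (Suc i) * d i \<omega>)"
    proof (rule summableI_nonneg_bounded)
      show "0 \<le> P (Suc i) * d i \<omega>" for i using P_pos[of "Suc i"] d_nn[of i \<omega>] by simp
      show "(\<Sum>i<n. P (Suc i) * d i \<omega>) \<le> K" for n using D_le[of n] by (simp add: D_def)
    qed
    have "summable (\<lambda>i. d i \<omega>)"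
    proof (rule summable_comparison_test'[OF summable_mult[OF sD, of "exp (suminf b)"]])
      fix i
      have "1 \<le> exp (suminf b) * P (Suc i)"
        using mult_left_mono[OF P_ge[of "Suc i"], of "exp (suminf b)"] by (simp flip: exp_add)
      from mult_right_mono[OF this d_nn[of i \<omega>]]
      show "norm (d i \<omega>) \<le> exp (suminf b) * (P (Suc i) * d i \<omega>)"
        using d_nn[of i \<omega>] by (simp add: mult.assoc)
    qed
    moreover have "convergent (\<lambda>n. (W n \<omega> - D n \<omega> - E n) / P n)"
    proof -
      obtain w e where "(\<lambda>n. W n \<omega>) \<longlonglongrightarrow> w" "E \<longlonglongrightarrow> e"
        using elim E_lim by (auto simp: convergent_def)
      moreover have "(\<lambda>n. D n \<omega>) \<longlonglongrightarrow> (\<Sum>i. P (Suc i) * d i \<omega>)"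
        unfolding D_def by (rule summable_LIMSEQ[OF sD])
      ultimately have "(\<lambda>n. (W n \<omega> - D n \<omega> - E n) / P n)
          \<longlonglongrightarrow> (w - (\<Sum>i. P (Suc i) * d i \<omega>) - e) / exp (- suminf b)"
        using P_lim by (intro tendsto_intros) auto
      then show ?thesis by (auto simp: convergent_def)
    qed
    moreover have "(\<lambda>n. (W n \<omega> - D n \<omega> - E n) / P n) = (\<lambda>n. V n \<omega>)"
      using P_pos by (auto simp: W_def less_imp_neq[THEN not_sym])
    ultimately show ?case by simp
  qed
qed

section \<open>Conditional independence and orthogonality\<close>

text \<open>Dynkin's argument: vanishing of the integral survives countable disjoint unions, and it
  passes to complements because the whole space belongs to the generator.\<close>

lemma (in finite_measure) set_integral_zero_sigma_sets:
  fixes f :: "'a \<Rightarrow> real"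
  assumes "Int_stable E" and E: "E \<subseteq> sets M" "space M \<in> E" and int: "integrable M f"
    and zero: "\<And>A. A \<in> E \<Longrightarrow> (LINT \<omega>:A|M. f \<omega>) = 0"
    and A: "A \<in> sigma_sets (space M) E"
  shows "(LINT \<omega>:A|M. f \<omega>) = 0"
proof -
  have si: "set_integrable M B f" if "B \<in> sets M" for B
    using integrable_mult_indicator[OF that int] by (simp add: set_integrable_def)
  have sM: "B \<in> sets M" if "B \<in> sigma_sets (space M) E" for B
    using sets.sigma_sets_subset[OF E(1)] that by blast
  have "E \<subseteq> Pow (space M)" using E(1) sets.sets_into_space by blast
  from \<open>Int_stable E\<close> this A show ?thesis
  proof (induction rule: sigma_sets_induct_disjoint)
    case (basic A)
    then show ?case by (rule zero)
  next
    case empty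
    show ?case by (simp add: set_lebesgue_integral_def)
  next
    case (compl A)
    have "(LINT \<omega>:A \<union> (space M - A)|M. f \<omega>) = (LINT \<omega>:A|M. f \<omega>) + (LINT \<omega>:space M - A|M. f \<omega>)"
      by (rule set_integral_Un) (auto intro!: si sM compl.hyps sigma_sets.Compl)
    moreover have "A \<union> (space M - A) = space M"
      using sets.sets_into_space[OF sM[OF compl.hyps]] by blast
    ultimately show ?case using zero[OF E(2)] compl by simp
  next
    case (union A)
    have "(LINT \<omega>:(\<Union>i. A i)|M. f \<omega>) = (\<Sum>i. LINT \<omega>:A i|M. f \<omega>)"
    proof (rule lebesgue_integral_countable_add)
      show "\<And>i. A i \<in> sets M" using union.hyps(2) sM by blast
      then show "set_integrable M (\<Union>i. A i) f" by (intro si) auto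
    qed (use union.hyps(1) in \<open>auto simp: disjoint_family_on_def\<close>)
    then show ?case by (simp add: union)
  qed
qed

text \<open>The join of \<open>H\<close> with the sigma-algebra of \<open>X\<close>. Intersections
  are used as generators, instead of the union of the two families, because they form an
  intersection-stable family.\<close>

definition enlarge :: "'w measure \<Rightarrow> 'c measure \<Rightarrow> ('w \<Rightarrow> 'c) \<Rightarrow> 'w measure" where
  "enlarge H S X = sigma (space H) {A \<inter> (X -` B \<inter> space H) | A B. A \<in> sets H \<and> B \<in> sets S}"

lemma sets_enlarge:
  "sets (enlarge H S X) = sigma_sets (space H) {A \<inter> (X -` B \<inter> space H) | A B. A \<in> sets H \<and> B \<in> sets S}"
  unfolding enlarge_def by (rule sets_measure_of) (auto dest: sets.sets_into_space)

lemma space_enlarge [simp]: "space (enlarge H S X) = space H"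
  unfolding enlarge_def by (rule space_measure_of_conv)

lemma measurable_enlarge1: "X \<in> space H \<rightarrow> space S \<Longrightarrow> f \<in> measurable H T \<Longrightarrow> f \<in> measurable (enlarge H S X) T"
  unfolding measurable_def sets_enlarge
  by (auto intro!: sigma_sets.Basic exI[of _ "space S"] dest: sets.sets_into_space)

lemma measurable_enlarge2: "X \<in> space H \<rightarrow> space S \<Longrightarrow> X \<in> measurable (enlarge H S X) S"
  unfolding measurable_def sets_enlarge
  by (auto intro!: sigma_sets.Basic exI[of _ "space H"] )

lemma Int_stable_enlarge:
  "Int_stable {A \<inter> (X -` B \<inter> space H) | A B. A \<in> sets H \<and> B \<in> sets S}"
proof (rule Int_stableI, clarify)
  fix A A' B B' assume "A \<in> sets H" "A' \<in> sets H" "B \<in> sets S" "B' \<in> sets S"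
  then show "\<exists>A'' B''. A \<inter> (X -` B \<inter> space H) \<inter> (A' \<inter> (X -` B' \<inter> space H))
      = A'' \<inter> (X -` B'' \<inter> space H) \<and> A'' \<in> sets H \<and> B'' \<in> sets S"
    by (intro exI[of _ "A \<inter> A'"] exI[of _ "B \<inter> B'"]) auto
qed

lemma enlarge_generator_subset:
  assumes "subalgebra M H" "X \<in> measurable M S"
  shows "{A \<inter> (X -` B \<inter> space H) | A B. A \<in> sets H \<and> B \<in> sets S} \<subseteq> sets M"
    "space M \<in> {A \<inter> (X -` B \<inter> space H) | A B. A \<in> sets H \<and> B \<in> sets S}"
proof -
  have sp: "space H = space M" using assms(1) by (simp add: subalgebra_def)
  have "A \<inter> (X -` B \<inter> space M) \<in> sets M" if "A \<in> sets H" "B \<in> sets S" for A B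
    using that assms(1) measurable_sets[OF assms(2)] by (auto simp: subalgebra_def)
  then show "{A \<inter> (X -` B \<inter> space H) | A B. A \<in> sets H \<and> B \<in> sets S} \<subseteq> sets M"
    unfolding sp by auto
  have "space M = space H \<inter> (X -` space S \<inter> space H)"
    using measurable_space[OF assms(2)] sp by auto
  then show "space M \<in> {A \<inter> (X -` B \<inter> space H) | A B. A \<in> sets H \<and> B \<in> sets S}"
    by auto
qed

lemma subalgebra_enlarge:
  assumes "subalgebra M H" "X \<in> measurable M S"
  shows "subalgebra M (enlarge H S X)"
proof -
  have sp: "space H = space M" using assms(1) by (simp add: subalgebra_def)
  show ?thesis
    using sets.sigma_sets_subset[OF enlarge_generator_subset(1)[OF assms]]
    by (simp add: subalgebra_def sets_enlarge sp)
qed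

text \<open>The generating intersections suffice as test sets, and on them the integral of
  \<open>f\<close> only involves a product of two indicators.\<close>

lemma (in prob_space) real_cond_exp_enlarge_zero:
  assumes sub: "subalgebra M H" and X: "X \<in> measurable M S" and f: "integrable M f"
    and zero: "\<And>A B. A \<in> sets H \<Longrightarrow> B \<in> sets S \<Longrightarrow> (LINT \<omega>|M. indicat_real A \<omega> * indicator B (X \<omega>) * f \<omega>) = 0"
  shows "AE \<omega> in M. real_cond_exp M (enlarge H S X) f \<omega> = 0"
proof -
  have subE: "subalgebra M (enlarge H S X)" by (rule subalgebra_enlarge[OF sub X])
  interpret E: finite_measure_subalgebra M "enlarge H S X"
    by unfold_locales (rule subE)
  have sp: "space H = space M" using sub by (simp add: subalgebra_def)
  show ?thesis
  proof (rule E.real_cond_exp_charact)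
    fix A assume A: "A \<in> sets (enlarge H S X)"
    have "(LINT \<omega>:A|M. f \<omega>) = 0"
    proof (rule set_integral_zero_sigma_sets[OF Int_stable_enlarge enlarge_generator_subset[OF sub X] f])
      show "A \<in> sigma_sets (space M) {A \<inter> (X -` B \<inter> space H) |A B. A \<in> sets H \<and> B \<in> sets S}"
        using A by (simp add: sets_enlarge sp)
      fix A assume "A \<in> {A \<inter> (X -` B \<inter> space H) |A B. A \<in> sets H \<and> B \<in> sets S}"
      then obtain A' B where *: "A = A' \<inter> (X -` B \<inter> space H)" "A' \<in> sets H" "B \<in> sets S" by auto
      have "(LINT \<omega>:A|M. f \<omega>) = (LINT \<omega>|M. indicat_real A' \<omega> * indicator B (X \<omega>) * f \<omega>)"
        unfolding set_lebesgue_integral_def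
        by (rule Bochner_Integration.integral_cong) (auto simp: * sp indicator_def)
      then show "(LINT \<omega>:A|M. f \<omega>) = 0" using zero * by simp
    qed
    then show "(LINT \<omega>:A|M. f \<omega>) = (LINT \<omega>:A|M. 0)"
      by (simp add: set_lebesgue_integral_def)
  qed (use f in auto)
qed

text \<open>No regular conditional distribution is available for a general sample space. Instead, first
  test \<open>r = 1\<^sub>B(X) - P(X \<in> B | H)\<close> against the join of \<open>H\<close> and \<open>Y\<close>; this lets
  \<open>1\<^sub>B(X)\<close> be replaced by an \<open>H\<close>-measurable function in integrals against \<open>v\<close>, so \<open>v\<close> also has
  conditional mean zero given the join of \<open>H\<close> and \<open>X\<close>.\<close>
lemma (in prob_space) cond_indep_imp_orthogonal:
  fixes u v :: "'a \<Rightarrow> real"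
  assumes sub: "subalgebra M H" and X: "X \<in> measurable M S" and Y: "Y \<in> measurable M T"
    and indep: "\<And>B C. B \<in> sets S \<Longrightarrow> C \<in> sets T \<Longrightarrow>
      AE \<omega> in M. real_cond_exp M H (\<lambda>\<omega>. indicator B (X \<omega>) * indicator C (Y \<omega>)) \<omega>
        = real_cond_exp M H (\<lambda>\<omega>. indicator B (X \<omega>)) \<omega> * real_cond_exp M H (\<lambda>\<omega>. indicator C (Y \<omega>)) \<omega>"
    and u: "u \<in> borel_measurable (enlarge H S X)" and v: "v \<in> borel_measurable (enlarge H T Y)"
    and v_int: "integrable M v" and uv: "integrable M (\<lambda>\<omega>. u \<omega> * v \<omega>)"
    and v_zero: "AE \<omega> in M. real_cond_exp M H v \<omega> = 0"
  shows "(LINT \<omega>|M. u \<omega> * v \<omega>) = 0"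
proof -
  interpret H: finite_measure_subalgebra M H by unfold_locales (rule sub)
  interpret HX: finite_measure_subalgebra M "enlarge H S X"
    by unfold_locales (rule subalgebra_enlarge[OF sub X])
  interpret HY: finite_measure_subalgebra M "enlarge H T Y"
    by unfold_locales (rule subalgebra_enlarge[OF sub Y])
  note [measurable] = X Y
  have vM [measurable]: "v \<in> borel_measurable M" using v_int by auto
  have HM: "A \<in> sets M" if "A \<in> sets H" for A using that sub by (auto simp: subalgebra_def)
  have sp: "space H = space M" using sub by (simp add: subalgebra_def)
  have YH: "Y \<in> space H \<rightarrow> space T" using measurable_space[OF Y] sp by auto
  have "AE \<omega> in M. real_cond_exp M (enlarge H S X) v \<omega> = 0"
  proof (rule real_cond_exp_enlarge_zero[OF sub X v_int])
    fix A B assume A [measurable]: "A \<in> sets H" and B [measurable]: "B \<in> sets S"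
    note HM[OF A, measurable]
    define p where "p = real_cond_exp M H (\<lambda>\<omega>. indicator B (X \<omega>))"
    have pH [measurable]: "p \<in> borel_measurable H" "p \<in> borel_measurable M" by (simp_all add: p_def)
    have iB: "integrable M (\<lambda>\<omega>. indicat_real B (X \<omega>))"
      by (rule integrable_const_bound[where B = 1]) (auto simp: indicator_def)
    have p_bd: "AE \<omega> in M. \<bar>p \<omega>\<bar> \<le> 1"
    proof -
      have "AE \<omega> in M. 0 \<le> p \<omega>" unfolding p_def by (rule H.real_cond_exp_pos) auto
      moreover have "AE \<omega> in M. p \<omega> \<le> 1"
        unfolding p_def by (rule H.real_cond_exp_le_c[OF iB]) (auto simp: indicator_def)
      ultimately show ?thesis by eventually_elim auto
    qed
    have ip: "integrable M p" unfolding p_def by (rule H.real_cond_exp_int(1)[OF iB])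
    have prod_int: "integrable M (\<lambda>\<omega>. g \<omega> * f \<omega>)" if "integrable M f" "g \<in> borel_measurable M"
      "AE \<omega> in M. \<bar>g \<omega>\<bar> \<le> 1" for f g :: "'a \<Rightarrow> real"
    proof (rule Bochner_Integration.integrable_bound[OF that(1)])
      show "(\<lambda>\<omega>. g \<omega> * f \<omega>) \<in> borel_measurable M" using that by measurable
      show "AE \<omega> in M. norm (g \<omega> * f \<omega>) \<le> norm (f \<omega>)"
        using that(3) by eventually_elim (simp add: abs_mult mult_left_le_one_le)
    qed
    have ind1: "\<bar>indicat_real D z\<bar> \<le> 1" for D :: "'z set" and z by (simp add: indicator_def)
    define r where "r \<omega> = indicator B (X \<omega>) - p \<omega>" for \<omega>
    have r_int: "integrable M r" unfolding r_def using iB ip by simp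
    \<comment> \<open>Both terms of \<open>r\<close> are bounded by 1, so \<open>r / 2\<close> meets
      the bound asked for by \<open>prod_int\<close>; \<open>iAvr\<close> restores the factor
      2.\<close>
    have r_bd: "AE \<omega> in M. \<bar>indicator A \<omega> * r \<omega> / 2\<bar> \<le> 1"
      using p_bd by eventually_elim (auto simp: r_def indicator_def)
    have rM [measurable]: "r \<in> borel_measurable M" using r_int by auto
    have r_zero: "AE \<omega> in M. real_cond_exp M (enlarge H T Y) r \<omega> = 0"
    proof (rule real_cond_exp_enlarge_zero[OF sub Y r_int])
      fix A' C assume A' [measurable]: "A' \<in> sets H" and C [measurable]: "C \<in> sets T"
      note HM[OF A', measurable]
      have iC: "integrable M (\<lambda>\<omega>. indicat_real C (Y \<omega>))"
        by (rule integrable_const_bound[where B = 1]) (auto simp: indicator_def)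
      have iBC: "integrable M (\<lambda>\<omega>. indicat_real B (X \<omega>) * indicat_real C (Y \<omega>))"
        by (rule integrable_const_bound[where B = 1]) (auto simp: indicator_def)
      \<comment> \<open>Condition on \<open>H\<close>, factor by conditional independence, then undo
        the conditioning of the \<open>Y\<close> indicator, now with the \<open>H\<close>-measurable
        weight \<open>indicat_real A' \<omega> * p \<omega>\<close>.\<close>
      have "(LINT \<omega>|M. indicat_real A' \<omega> * (indicat_real B (X \<omega>) * indicat_real C (Y \<omega>)))
          = (LINT \<omega>|M. indicat_real A' \<omega> * real_cond_exp M H (\<lambda>\<omega>. indicator B (X \<omega>) * indicator C (Y \<omega>)) \<omega>)"
        by (rule H.real_cond_exp_intg(2)[symmetric]) (auto intro!: prod_int iBC ind1)
      also have "\<dots> = (LINT \<omega>|M. (indicat_real A' \<omega> * p \<omega>) * real_cond_exp M H (\<lambda>\<omega>. indicator C (Y \<omega>)) \<omega>)"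
      proof (rule integral_cong_AE)
        show "AE \<omega> in M. indicat_real A' \<omega> * real_cond_exp M H (\<lambda>\<omega>. indicator B (X \<omega>) * indicator C (Y \<omega>)) \<omega>
            = indicat_real A' \<omega> * p \<omega> * real_cond_exp M H (\<lambda>\<omega>. indicator C (Y \<omega>)) \<omega>"
          using indep[OF B C] by eventually_elim (simp add: p_def)
      qed auto
      also have "\<dots> = (LINT \<omega>|M. (indicat_real A' \<omega> * p \<omega>) * indicator C (Y \<omega>))"
      proof (rule H.real_cond_exp_intg(2))
        show "integrable M (\<lambda>\<omega>. indicat_real A' \<omega> * p \<omega> * indicator C (Y \<omega>))"
          by (rule prod_int[OF iC]) (use p_bd in \<open>auto elim!: eventually_mono simp: indicator_def\<close>)
      qed auto
      finally have *: "(LINT \<omega>|M. indicat_real A' \<omega> * (indicat_real B (X \<omega>) * indicat_real C (Y \<omega>)))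
          = (LINT \<omega>|M. (indicat_real A' \<omega> * p \<omega>) * indicator C (Y \<omega>))" .
      have "(LINT \<omega>|M. indicat_real A' \<omega> * indicator C (Y \<omega>) * r \<omega>)
          = (LINT \<omega>|M. indicat_real A' \<omega> * (indicat_real B (X \<omega>) * indicat_real C (Y \<omega>))
             - (indicat_real A' \<omega> * p \<omega>) * indicator C (Y \<omega>))"
        by (rule Bochner_Integration.integral_cong) (auto simp: r_def algebra_simps)
      also have "\<dots> = 0"
      proof (subst Bochner_Integration.integral_diff)
        show "integrable M (\<lambda>\<omega>. indicat_real A' \<omega> * (indicat_real B (X \<omega>) * indicat_real C (Y \<omega>)))"
          by (intro prod_int iBC) (auto simp: ind1)
        show "integrable M (\<lambda>\<omega>. indicat_real A' \<omega> * p \<omega> * indicator C (Y \<omega>))"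
          by (rule prod_int[OF iC]) (use p_bd in \<open>auto elim!: eventually_mono simp: indicator_def\<close>)
      qed (simp add: *)
      finally show "(LINT \<omega>|M. indicat_real A' \<omega> * indicator C (Y \<omega>) * r \<omega>) = 0" .
    qed
    have Av: "(\<lambda>\<omega>. indicat_real A \<omega> * v \<omega>) \<in> borel_measurable (enlarge H T Y)"
      using v measurable_enlarge1[OF YH, of "indicat_real A" borel] A by simp
    have iAvr: "integrable M (\<lambda>\<omega>. (indicat_real A \<omega> * v \<omega>) * r \<omega>)"
      using integrable_mult_right[OF prod_int[OF v_int _ r_bd], of 2] by (simp add: ac_simps)
    \<comment> \<open>\<open>v\<close> is measurable for the join of \<open>H\<close> and
      \<open>Y\<close>, given which \<open>r\<close> has conditional mean zero; so \<open>r\<close>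
      is orthogonal to it.\<close>
    have "(LINT \<omega>|M. (indicat_real A \<omega> * v \<omega>) * r \<omega>)
        = (LINT \<omega>|M. (indicat_real A \<omega> * v \<omega>) * real_cond_exp M (enlarge H T Y) r \<omega>)"
      by (rule HY.real_cond_exp_intg(2)[symmetric, OF iAvr Av rM])
    also have "\<dots> = (LINT \<omega>|M. 0)"
      by (rule integral_cong_AE) (use r_zero in \<open>auto elim!: eventually_mono\<close>)
    finally have 1: "(LINT \<omega>|M. (indicat_real A \<omega> * v \<omega>) * r \<omega>) = 0" by simp
    have iApv: "integrable M (\<lambda>\<omega>. (indicat_real A \<omega> * p \<omega>) * v \<omega>)"
      by (rule prod_int[OF v_int]) (use p_bd in \<open>auto elim!: eventually_mono simp: indicator_def\<close>)
    have "(LINT \<omega>|M. (indicat_real A \<omega> * p \<omega>) * v \<omega>)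
        = (LINT \<omega>|M. (indicat_real A \<omega> * p \<omega>) * real_cond_exp M H v \<omega>)"
      by (rule H.real_cond_exp_intg(2)[symmetric, OF iApv]) auto
    also have "\<dots> = (LINT \<omega>|M. 0)"
      by (rule integral_cong_AE) (use v_zero in \<open>auto elim!: eventually_mono\<close>)
    finally have 2: "(LINT \<omega>|M. (indicat_real A \<omega> * p \<omega>) * v \<omega>) = 0" by simp
    have "(LINT \<omega>|M. indicat_real A \<omega> * indicator B (X \<omega>) * v \<omega>)
        = (LINT \<omega>|M. (indicat_real A \<omega> * v \<omega>) * r \<omega> + (indicat_real A \<omega> * p \<omega>) * v \<omega>)"
      by (rule Bochner_Integration.integral_cong) (auto simp: r_def algebra_simps)
    also have "\<dots> = 0" using iAvr iApv 1 2 by simp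
    finally show "(LINT \<omega>|M. indicat_real A \<omega> * indicator B (X \<omega>) * v \<omega>) = 0" .
  qed
  moreover have uM: "u \<in> borel_measurable M"
    by (rule measurable_from_subalg[OF subalgebra_enlarge[OF sub X] u])
  ultimately have "(LINT \<omega>|M. u \<omega> * real_cond_exp M (enlarge H S X) v \<omega>) = (LINT \<omega>|M. 0)"
    by (intro integral_cong_AE) (auto elim!: eventually_mono)
  then show ?thesis using HX.real_cond_exp_intg(2)[OF uv u vM] by simp
qed

section \<open>The reflected gradient step\<close>

lemma two_inner_le:
  fixes u v :: "'a::real_inner"
  assumes "c > 0"
  shows "2 * (u \<bullet> v) \<le> c * (norm u)\<^sup>2 + (norm v)\<^sup>2 / c"
proof -
  have "0 \<le> (norm (c *\<^sub>R u - v))\<^sup>2" by simp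
  also have "\<dots> = c * (c * (norm u)\<^sup>2 + (norm v)\<^sup>2 / c - 2 * (u \<bullet> v))"
    using assms by (simp add: power2_norm_eq_inner inner_diff_left inner_diff_right inner_commute algebra_simps)
  finally show ?thesis using assms by (simp add: zero_le_mult_iff)
qed

lemma norm_add_sq_le: "(norm (u + v :: 'a::real_inner))\<^sup>2 \<le> 2 * (norm u)\<^sup>2 + 2 * (norm v)\<^sup>2"
  using two_inner_le[of 1 u v] by (simp add: power2_norm_eq_inner inner_add_left inner_add_right inner_commute)

text \<open>Malitsky's estimate for the projected reflected gradient step, with errors \<open>w\<close>, \<open>w'\<close> in
  two consecutive evaluations of F: the projection inequality at \<open>x1\<close> is tested against both \<open>x2\<close> and
  \<open>x0\<close>, which replaces F(y') by F(y) at the cost of a Lipschitz term.\<close>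
lemma reflected_gradient_step:
  fixes X :: "'a::euclidean_space set"
  assumes X: "closed X" "convex X"
    and lip: "L-lipschitz_on UNIV F" and mono: "monotone_op F"
    and xs: "xs \<in> X" and x0: "x0 \<in> X"
    and x1: "x1 = closest_point X (x0 - \<gamma> *\<^sub>R (F y + w))"
    and y': "y' = 2 *\<^sub>R x1 - x0"
    and x2: "x2 = closest_point X (x1 - \<gamma> *\<^sub>R (F y' + w'))"
    and \<gamma>: "0 < \<gamma>" "8 * \<gamma> * L \<le> 1"
  shows "(norm (x2 - xs))\<^sup>2 + (1/4) * (norm (x2 - y'))\<^sup>2 + 4 * \<gamma> * (F xs \<bullet> (x1 - xs))
    \<le> (norm (x1 - xs))\<^sup>2 + (1/8) * (norm (x1 - y))\<^sup>2 + 2 * \<gamma> * (F xs \<bullet> (x0 - xs))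
      - (7/8) * (norm (x1 - x0))\<^sup>2 - 2 * \<gamma> * (w' \<bullet> (y' - xs))
      + 4 * \<gamma>\<^sup>2 * (norm w)\<^sup>2 + 4 * \<gamma>\<^sup>2 * (norm w')\<^sup>2"
proof -
  define g g' where "g = F y + w" and "g' = F y' + w'"
  have L: "0 \<le> L" by (rule lipschitz_on_nonneg[OF lip])
  have X_ne: "X \<noteq> {}" using xs by blast
  have x1X: "x1 \<in> X" and x2X: "x2 \<in> X" unfolding x1 x2 by (intro closest_point_in_set X X_ne)+
  have p2: "(x1 - \<gamma> *\<^sub>R g' - x2) \<bullet> (xs - x2) \<le> 0"
    using closest_point_dot[OF X(2,1) xs, of "x1 - \<gamma> *\<^sub>R g'"] unfolding g'_def x2[symmetric] .
  have p1: "(x0 - \<gamma> *\<^sub>R g - x1) \<bullet> (z - x1) \<le> 0" if "z \<in> X" for z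
    using closest_point_dot[OF X(2,1) that, of "x0 - \<gamma> *\<^sub>R g"] unfolding g_def x1[symmetric] .
  have A: "(norm (x2 - xs))\<^sup>2 \<le> (norm (x1 - xs))\<^sup>2 - (norm (x2 - x1))\<^sup>2 - 2 * \<gamma> * (g' \<bullet> (x2 - xs))"
    using p2 by (simp add: power2_norm_eq_inner inner_diff_left inner_diff_right inner_commute algebra_simps)
  \<comment> \<open>\<open>y' - x2\<close> is the sum of \<open>x1 - x2\<close> and
    \<open>x1 - x0\<close>, so the tests of the projection at \<open>x1\<close> against
    \<open>x2\<close> and against \<open>x0\<close> add up; the second one requires
    \<open>x0 \<in> X\<close>. The positive square here cancels the negative one in
    \<open>A\<close>.\<close>
  have B: "2 * \<gamma> * (g \<bullet> (y' - x2)) \<le> (norm (x2 - x1))\<^sup>2 - (norm (x1 - x0))\<^sup>2 - (norm (x2 - y'))\<^sup>2"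
    using p1[OF x2X] p1[OF x0] unfolding y'
    by (simp add: power2_norm_eq_inner inner_diff_left inner_diff_right inner_commute algebra_simps)
  have C: "F xs \<bullet> (y' - xs) \<le> F y' \<bullet> (y' - xs)"
    using mono unfolding monotone_op_def by (simp add: inner_diff_left)
  have C': "F xs \<bullet> (y' - xs) = 2 * (F xs \<bullet> (x1 - xs)) - F xs \<bullet> (x0 - xs)"
    unfolding y' by (simp add: inner_diff_right algebra_simps)
  \<comment> \<open>Only the pairing of \<open>w'\<close> with \<open>y' - xs\<close> keeps a
    first-order error; what remains of the errors multiplies \<open>y' - x2\<close> and can be
    estimated by squares.\<close>
  have split: "g' \<bullet> (x2 - xs) = F y' \<bullet> (y' - xs) + w' \<bullet> (y' - xs) - g \<bullet> (y' - x2)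
      - (F y' - F y) \<bullet> (y' - x2) - (w' - w) \<bullet> (y' - x2)"
    unfolding g_def g'_def by (simp add: inner_add_left inner_diff_left inner_diff_right)
  \<comment> \<open>The steplength bound reduces the Lipschitz term to
    \<open>(p + q) * r / 4\<close>. Of the full square of \<open>norm (x2 - y')\<close> supplied by
    \<open>B\<close>, a quarter is spent here and a half in \<open>E\<close>, leaving the quarter in
    the conclusion.\<close>
  have D: "2 * \<gamma> * ((F y' - F y) \<bullet> (y' - x2)) \<le> (1/8) * (norm (x1 - x0))\<^sup>2 + (1/8) * (norm (x1 - y))\<^sup>2 + (1/4) * (norm (x2 - y'))\<^sup>2"
  proof -
    define p q r where "p = norm (x1 - x0)" and "q = norm (x1 - y)" and "r = norm (x2 - y')"
    have nn: "0 \<le> p" "0 \<le> q" "0 \<le> r" by (simp_all add: p_def q_def r_def)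
    have "norm (y' - y) \<le> p + q"
      using norm_triangle_ineq[of "x1 - x0" "x1 - y"] unfolding p_def q_def y'
      by (simp add: algebra_simps scaleR_2)
    then have "norm (F y' - F y) \<le> L * (p + q)"
      using lipschitz_onD[OF lip, of y' y] L mult_left_mono[of "norm (y' - y)" "p + q" L]
      by (simp add: dist_norm)
    then have "(F y' - F y) \<bullet> (y' - x2) \<le> L * (p + q) * r"
      using norm_cauchy_schwarz[of "F y' - F y" "y' - x2"] nn
        mult_right_mono[of "norm (F y' - F y)" "L * (p + q)" r]
      by (simp add: r_def norm_minus_commute)
    then have "2 * \<gamma> * ((F y' - F y) \<bullet> (y' - x2)) \<le> 2 * \<gamma> * (L * (p + q) * r)"
      using \<gamma>(1) by (intro mult_left_mono) auto
    also have "\<dots> = (8 * \<gamma> * L) * ((p + q) * r / 4)" by simp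
    also have "\<dots> \<le> 1 * ((p + q) * r / 4)"
      using \<gamma>(2) nn by (intro mult_right_mono) auto
    also have "\<dots> \<le> (1/8) * p\<^sup>2 + (1/8) * q\<^sup>2 + (1/4) * r\<^sup>2"
      using zero_le_power2[of "p - r"] zero_le_power2[of "q - r"]
      by (simp add: power2_eq_square algebra_simps)
    finally show ?thesis by (simp add: p_def q_def r_def)
  qed
  have E: "2 * \<gamma> * ((w' - w) \<bullet> (y' - x2)) \<le> (1/2) * (norm (x2 - y'))\<^sup>2 + 4 * \<gamma>\<^sup>2 * (norm w)\<^sup>2 + 4 * \<gamma>\<^sup>2 * (norm w')\<^sup>2"
  proof -
    have "2 * ((\<gamma> *\<^sub>R (w' - w)) \<bullet> (y' - x2)) \<le> 2 * (norm (\<gamma> *\<^sub>R (w' - w)))\<^sup>2 + (norm (y' - x2))\<^sup>2 / 2"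
      by (rule two_inner_le) simp
    moreover have "(norm (w' - w))\<^sup>2 \<le> 2 * (norm w')\<^sup>2 + 2 * (norm w)\<^sup>2"
      using norm_add_sq_le[of w' "- w"] by simp
    then have "\<gamma>\<^sup>2 * (norm (w' - w))\<^sup>2 \<le> \<gamma>\<^sup>2 * (2 * (norm w')\<^sup>2 + 2 * (norm w)\<^sup>2)"
      by (intro mult_left_mono) auto
    moreover have "(norm (\<gamma> *\<^sub>R (w' - w)))\<^sup>2 = \<gamma>\<^sup>2 * (norm (w' - w))\<^sup>2"
      by (simp only: norm_scaleR power_mult_distrib power2_abs)
    ultimately show ?thesis
      by (simp only: inner_scaleR_left norm_minus_commute[of y' x2] distrib_left mult.assoc)
  qed
  have "2 * \<gamma> * (F xs \<bullet> (y' - xs)) \<le> 2 * \<gamma> * (F y' \<bullet> (y' - xs))"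
    using C \<gamma>(1) by simp
  moreover have "2 * \<gamma> * (g' \<bullet> (x2 - xs)) = 2 * \<gamma> * (F y' \<bullet> (y' - xs)) + 2 * \<gamma> * (w' \<bullet> (y' - xs))
      - 2 * \<gamma> * (g \<bullet> (y' - x2)) - 2 * \<gamma> * ((F y' - F y) \<bullet> (y' - x2)) - 2 * \<gamma> * ((w' - w) \<bullet> (y' - x2))"
    unfolding split by (simp add: algebra_simps)
  moreover have "2 * \<gamma> * (F xs \<bullet> (y' - xs)) = 4 * \<gamma> * (F xs \<bullet> (x1 - xs)) - 2 * \<gamma> * (F xs \<bullet> (x0 - xs))"
    unfolding C' by (simp add: algebra_simps)
  ultimately show ?thesis using A B D E by linarith
qed

text \<open>Boundedness of \<open>x\<close> is not assumed: the nearest points lie in the compact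
  \<open>S\<close>, and a cluster point of these is one of \<open>x\<close> since the distances
  vanish. Passing from \<open>D\<close> to \<open>S\<close> works because replacing \<open>p\<close>
  by a nearby \<open>q\<close> changes \<open>norm (x n - p)\<close> by at most
  \<open>dist q p\<close>, uniformly in \<open>n\<close>.\<close>

lemma Fejer_convergent:
  fixes x :: "nat \<Rightarrow> 'a::euclidean_space"
  assumes S: "compact S" "S \<noteq> {}" and D: "D \<subseteq> S" "S \<subseteq> closure D"
    and conv: "\<And>p. p \<in> D \<Longrightarrow> convergent (\<lambda>n. norm (x n - p))"
    and dist: "(\<lambda>n. infdist (x n) S) \<longlonglongrightarrow> 0"
  shows "\<exists>p\<in>S. x \<longlonglongrightarrow> p"
proof -
  have conv': "convergent (\<lambda>n. norm (x n - p))" if "p \<in> S" for p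
  proof (rule Cauchy_convergent, rule metric_CauchyI)
    fix e :: real assume "0 < e"
    have "p \<in> closure D" using that D by blast
    then obtain q where q: "q \<in> D" "dist q p < e / 4"
      unfolding closure_approachable using \<open>0 < e\<close> by (meson divide_pos_pos zero_less_numeral)
    have "Cauchy (\<lambda>n. norm (x n - q))" using conv[OF q(1)] by (rule convergent_Cauchy)
    then obtain M where M: "\<And>m n. m \<ge> M \<Longrightarrow> n \<ge> M \<Longrightarrow> dist (norm (x m - q)) (norm (x n - q)) < e / 4"
      using \<open>0 < e\<close> by (meson metric_CauchyD divide_pos_pos zero_less_numeral)
    have near: "\<bar>norm (x n - p) - norm (x n - q)\<bar> < e / 4" for n
      using norm_triangle_ineq3[of "x n - p" "x n - q"] q(2) by (simp add: dist_norm)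
    show "\<exists>M. \<forall>m\<ge>M. \<forall>n\<ge>M. dist (norm (x m - p)) (norm (x n - p)) < e"
    proof (intro exI[of _ M] allI impI)
      fix m n assume "M \<le> m" "M \<le> n"
      then have "dist (norm (x m - q)) (norm (x n - q)) < e / 4" by (rule M)
      then show "dist (norm (x m - p)) (norm (x n - p)) < e"
        using near[of m] near[of n] unfolding dist_real_def abs_less_iff by linarith
    qed
  qed
  have "\<exists>p\<in>S. infdist (x n) S = dist (x n) p" for n
    using infdist_attains_inf[OF compact_imp_closed[OF S(1)] S(2)] by metis
  then have "\<forall>n. \<exists>p. p \<in> S \<and> infdist (x n) S = dist (x n) p" by blast
  from choice[OF this] obtain z where z: "\<And>n. z n \<in> S" "\<And>n. infdist (x n) S = dist (x n) (z n)" by blast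
  obtain p r where pr: "p \<in> S" "strict_mono r" "(z \<circ> r) \<longlonglongrightarrow> p"
    using S(1) z(1) unfolding compact_def by metis
  have xz: "(\<lambda>n. dist (x (r n)) (z (r n))) \<longlonglongrightarrow> 0"
    using LIMSEQ_subseq_LIMSEQ[OF dist pr(2)] by (simp add: z(2) o_def)
  have zp: "(\<lambda>n. dist (z (r n)) p) \<longlonglongrightarrow> 0"
    using pr(3) unfolding tendsto_dist_iff[of "z \<circ> r"] by simp
  have xp: "(\<lambda>n. dist (x (r n)) (z (r n)) + dist (z (r n)) p) \<longlonglongrightarrow> 0"
    using tendsto_add[OF xz zp] by simp
  have sub: "(\<lambda>n. norm (x (r n) - p)) \<longlonglongrightarrow> 0"
  proof (rule tendsto_sandwich[OF _ _ tendsto_const xp])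
    have "norm (x (r n) - p) \<le> dist (x (r n)) (z (r n)) + dist (z (r n)) p" for n
      using dist_triangle[of "x (r n)" p "z (r n)"] by (simp only: dist_norm)
    then show "\<forall>\<^sub>F n in sequentially. norm (x (r n) - p) \<le> dist (x (r n)) (z (r n)) + dist (z (r n)) p"
      by simp
  qed simp
  obtain l where l: "(\<lambda>n. norm (x n - p)) \<longlonglongrightarrow> l" using conv'[OF pr(1)] by (auto simp: convergent_def)
  have "l = 0"
    using LIMSEQ_unique[OF LIMSEQ_subseq_LIMSEQ[OF l pr(2), unfolded o_def] sub] .
  with l have "x \<longlonglongrightarrow> p" unfolding tendsto_dist_iff[of x] by (simp add: dist_norm)
  then show ?thesis using pr(1) by blast
qed

section \<open>Square-integrable noise\<close>

text \<open>Second moments are what is propagated along the iteration: they make inner products of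
  errors with iterates integrable, and sums and Lipschitz images preserve them.\<close>

definition square_integrable :: "'w measure \<Rightarrow> ('w \<Rightarrow> 'a::euclidean_space) \<Rightarrow> bool" where
  "square_integrable M f \<longleftrightarrow> f \<in> borel_measurable M \<and> integrable M (\<lambda>\<omega>. (norm (f \<omega>))\<^sup>2)"

lemma square_integrableD:
  assumes "square_integrable M f"
  shows "f \<in> borel_measurable M" "integrable M (\<lambda>\<omega>. (norm (f \<omega>))\<^sup>2)"
  using assms by (simp_all add: square_integrable_def)

lemma square_integrable_bound:
  assumes "square_integrable M f" "g \<in> borel_measurable M" "\<And>\<omega>. norm (g \<omega>) \<le> norm (f \<omega>)"
  shows "square_integrable M g"
  unfolding square_integrable_def
proof
  show "integrable M (\<lambda>\<omega>. (norm (g \<omega>))\<^sup>2)"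
    by (rule Bochner_Integration.integrable_bound[OF square_integrableD(2)[OF assms(1)]])
      (use assms in \<open>auto intro: power_mono\<close>)
qed fact

lemma square_integrable_add:
  assumes "square_integrable M f" "square_integrable M g"
  shows "square_integrable M (\<lambda>\<omega>. f \<omega> + g \<omega>)"
  unfolding square_integrable_def
proof
  note [measurable] = square_integrableD(1)[OF assms(1)] square_integrableD(1)[OF assms(2)]
  show "(\<lambda>\<omega>. f \<omega> + g \<omega>) \<in> borel_measurable M" by measurable
  show "integrable M (\<lambda>\<omega>. (norm (f \<omega> + g \<omega>))\<^sup>2)"
  proof (rule Bochner_Integration.integrable_bound)
    show "integrable M (\<lambda>\<omega>. 2 * (norm (f \<omega>))\<^sup>2 + 2 * (norm (g \<omega>))\<^sup>2)"
      using assms by (auto simp: square_integrable_def)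
    show "AE \<omega> in M. norm ((norm (f \<omega> + g \<omega>))\<^sup>2) \<le> norm (2 * (norm (f \<omega>))\<^sup>2 + 2 * (norm (g \<omega>))\<^sup>2)"
      using norm_add_sq_le by (auto simp: abs_of_nonneg)
  qed measurable
qed

lemma square_integrable_scaleR:
  "square_integrable M f \<Longrightarrow> square_integrable M (\<lambda>\<omega>. c *\<^sub>R f \<omega>)"
  unfolding square_integrable_def by (auto simp: power_mult_distrib)

lemma square_integrable_diff:
  "square_integrable M f \<Longrightarrow> square_integrable M g \<Longrightarrow> square_integrable M (\<lambda>\<omega>. f \<omega> - g \<omega>)"
  using square_integrable_add[OF _ square_integrable_scaleR[of M g "-1"]] by simp

lemma (in finite_measure) square_integrable_const: "square_integrable M (\<lambda>\<omega>. c)"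
  by (simp add: square_integrable_def)

lemma square_integrable_sum:
  "(\<And>i. i \<in> I \<Longrightarrow> square_integrable M (f i)) \<Longrightarrow> square_integrable M (\<lambda>\<omega>. \<Sum>i\<in>I. f i \<omega>)"
  by (induction I rule: infinite_finite_induct)
    (auto simp: square_integrable_add, auto simp: square_integrable_def)

lemma square_integrable_norm:
  "square_integrable M f \<Longrightarrow> square_integrable M (\<lambda>\<omega>. norm (f \<omega>))"
  by (auto simp: square_integrable_def)

lemma square_integrable_component:
  "square_integrable M f \<Longrightarrow> b \<in> Basis \<Longrightarrow> square_integrable M (\<lambda>\<omega>. f \<omega> \<bullet> b)"
  by (rule square_integrable_bound[OF square_integrable_norm])
    (auto simp: Basis_le_norm square_integrable_def)

lemma square_integrable_indicator:
  "square_integrable M f \<Longrightarrow> A \<in> sets M \<Longrightarrow> square_integrable M (\<lambda>\<omega>. indicat_real A \<omega> *\<^sub>R f \<omega>)"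
  by (rule square_integrable_bound[of M f]) (auto simp: square_integrable_def indicator_def)

lemma integrable_inner:
  fixes f g :: "'w \<Rightarrow> 'b::euclidean_space"
  assumes "square_integrable M f" "square_integrable M g"
  shows "integrable M (\<lambda>\<omega>. f \<omega> \<bullet> g \<omega>)"
proof (rule Bochner_Integration.integrable_bound)
  note [measurable] = square_integrableD(1)[OF assms(1)] square_integrableD(1)[OF assms(2)]
  show "integrable M (\<lambda>\<omega>. (norm (f \<omega>))\<^sup>2 + (norm (g \<omega>))\<^sup>2)"
    using assms by (auto simp: square_integrable_def)
  have "\<bar>u \<bullet> v\<bar> \<le> (norm u)\<^sup>2 + (norm v)\<^sup>2" for u v :: 'b
    using two_inner_le[of 1 u v] two_inner_le[of 1 "- u" v] zero_le_power2[of "norm u"] zero_le_power2[of "norm v"]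
    unfolding abs_le_iff by (simp del: zero_le_power2)
  then show "AE \<omega> in M. norm (f \<omega> \<bullet> g \<omega>) \<le> norm ((norm (f \<omega>))\<^sup>2 + (norm (g \<omega>))\<^sup>2)"
    by (auto simp: abs_of_nonneg)
qed (use assms in \<open>auto simp: square_integrable_def\<close>)

lemma (in finite_measure) integrable_inner_const:
  "square_integrable M f \<Longrightarrow> integrable M (\<lambda>\<omega>. c \<bullet> f \<omega>)"
  by (rule integrable_inner[OF square_integrable_const])

text \<open>A Lipschitz map grows at most linearly; this serves both \<open>F\<close> and the
  projection.\<close>

lemma (in finite_measure) square_integrable_lipschitz:
  assumes "L-lipschitz_on UNIV f" "square_integrable M g"
  shows "square_integrable M (\<lambda>\<omega>. f (g \<omega>))"
proof (rule square_integrable_bound)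
  have "f \<in> borel_measurable borel"
    by (intro borel_measurable_continuous_onI lipschitz_on_continuous_on[OF assms(1)])
  then show "(\<lambda>\<omega>. f (g \<omega>)) \<in> borel_measurable M"
    using square_integrableD(1)[OF assms(2)] by simp
  show "square_integrable M (\<lambda>\<omega>. norm (f 0) + L *\<^sub>R norm (g \<omega>))"
    by (intro square_integrable_add square_integrable_const square_integrable_scaleR
        square_integrable_norm assms)
  show "norm (f (g \<omega>)) \<le> norm (norm (f 0) + L *\<^sub>R norm (g \<omega>))" for \<omega>
    using lipschitz_onD[OF assms(1), of "g \<omega>" 0] norm_triangle_ineq2[of "f (g \<omega>)" "f 0"]
    by (simp add: dist_norm)
qed

lemma lipschitz_closest_point:
  assumes "convex X" "closed X" "X \<noteq> {}"
  shows "1-lipschitz_on UNIV (closest_point X)"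
  using closest_point_lipschitz[OF assms] by (auto intro: lipschitz_onI)

section \<open>The Lyapunov function of the noisy reflected iteration\<close>

lemma VI_solD:
  assumes "xs \<in> VI_sol X F"
  shows "xs \<in> X" "x \<in> X \<Longrightarrow> 0 \<le> F xs \<bullet> (x - xs)"
  using assms by (auto simp: VI_sol_def)

text \<open>The Robbins--Siegmund theorem is applied to the Lyapunov function \<open>V\<close> below. Since \<open>y n\<close> is a
  reflected point, monotonicity contributes the gap terms \<open>2 a\<^sub>n\<^sub>+\<^sub>1 - a\<^sub>n\<close> with
  \<open>a\<^sub>n = F xs \<bullet> (x n - xs) \<ge> 0\<close>, which telescope up to a summable remainder. The index of \<open>V\<close>
  is shifted by one because the step estimate needs two consecutive iterates in \<open>X\<close>, and
  \<open>x\<^sub>-\<^sub>1\<close> may lie outside.\<close>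
lemma (in prob_space) noisy_reflected_gradient_Fejer:
  fixes x y w :: "nat \<Rightarrow> 'a \<Rightarrow> 'b::euclidean_space"
  assumes sub: "\<And>n. subalgebra M (H n)" and H_mono: "\<And>n. sets (H n) \<subseteq> sets (H (Suc n))"
    and X: "closed X" "convex X"
    and lip: "L-lipschitz_on UNIV F" and mono: "monotone_op F"
    and xs: "xs \<in> VI_sol X F"
    and \<gamma>: "0 < \<gamma>" "8 * \<gamma> * L \<le> 1"
    and N: "\<And>n. 1 \<le> N n" "\<And>n. 64 * \<gamma>\<^sup>2 * \<nu>1\<^sup>2 \<le> real (N n)" "summable (\<lambda>n. 1 / real (N (Suc n)))"
    and x_in: "\<And>n \<omega>. x n \<omega> \<in> X"
    and x_step: "\<And>n \<omega>. x (Suc n) \<omega> = closest_point X (x n \<omega> - \<gamma> *\<^sub>R (F (y n \<omega>) + w n \<omega>))"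
    and y_step: "\<And>n \<omega>. y (Suc n) \<omega> = 2 *\<^sub>R x (Suc n) \<omega> - x n \<omega>"
    and x_meas: "\<And>n. x n \<in> borel_measurable (H n)" and y_meas: "\<And>n. y n \<in> borel_measurable (H n)"
    and w_meas: "\<And>n. w n \<in> borel_measurable (H (Suc n))"
    and x_sq: "\<And>n. square_integrable M (x n)" and y_sq: "\<And>n. square_integrable M (y n)"
    and w_sq: "\<And>n. square_integrable M (w n)"
    and mean: "\<And>n f. f \<in> borel_measurable (H n) \<Longrightarrow> square_integrable M f \<Longrightarrow> (LINT \<omega>|M. w n \<omega> \<bullet> f \<omega>) = 0"
    and var: "\<And>n A. A \<in> sets (H n) \<Longrightarrow> (LINT \<omega>:A|M. (norm (w n \<omega>))\<^sup>2)
      \<le> (LINT \<omega>:A|M. (\<nu>1\<^sup>2 * (norm (y n \<omega>))\<^sup>2 + \<nu>2\<^sup>2) / real (N n))"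
  shows "AE \<omega> in M. convergent (\<lambda>n. norm (x n \<omega> - xs)) \<and> (\<lambda>n. F xs \<bullet> (x n \<omega> - xs)) \<longlonglongrightarrow> 0"
proof -
  define V where "V n \<omega> = (norm (x (Suc n) \<omega> - xs))\<^sup>2 + (1/8) * (norm (x (Suc n) \<omega> - y n \<omega>))\<^sup>2
      + 2 * \<gamma> * (F xs \<bullet> (x n \<omega> - xs)) + 4 * \<gamma>\<^sup>2 * (norm (w n \<omega>))\<^sup>2" for n \<omega>
  \<comment> \<open>\<open>d n\<close> is \<open>V (Suc n)\<close> without the squared distance. Its
    summability makes these terms vanish, so that the limit of \<open>V\<close> is the limit of the
    squared distance to \<open>xs\<close>.\<close>
  define d where "d n \<omega> = (1/8) * (norm (x (Suc (Suc n)) \<omega> - y (Suc n) \<omega>))\<^sup>2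
      + 2 * \<gamma> * (F xs \<bullet> (x (Suc n) \<omega> - xs)) + 4 * \<gamma>\<^sup>2 * (norm (w (Suc n) \<omega>))\<^sup>2" for n \<omega>
  \<comment> \<open>The new squared error occurs with factor \<open>4 * \<gamma>\<^sup>2\<close>
    three times, in the step estimate, in \<open>V (Suc n)\<close> and in \<open>d n\<close>, which
    makes 12. The squared norm of \<open>y (Suc n)\<close> is at most
    \<open>4 * q + 4 * p + 2 * (norm xs)\<^sup>2\<close>, with \<open>p\<close> and \<open>q\<close>
    as in \<open>absorb\<close>; hence 48 here, and the \<open>xs\<close> part goes to
    \<open>c\<close>.\<close>
  define b where "b n = 48 * \<gamma>\<^sup>2 * \<nu>1\<^sup>2 * (1 / real (N (Suc n)))" for n
  define c where "c n = 12 * \<gamma>\<^sup>2 * (2 * \<nu>1\<^sup>2 * (norm xs)\<^sup>2 + \<nu>2\<^sup>2) * (1 / real (N (Suc n)))" for n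
  have a_nn: "0 \<le> F xs \<bullet> (x n \<omega> - xs)" for n \<omega> using VI_solD(2)[OF xs x_in] .
  have lift: "f \<in> measurable (H (Suc n)) T" if "f \<in> measurable (H n) T" for f n and T :: "'c measure"
  proof -
    have "space (H (Suc n)) = space (H n)" using sub by (simp add: subalgebra_def)
    then show ?thesis using that H_mono[of n] by (auto simp: measurable_def)
  qed
  have V_meas: "V n \<in> borel_measurable (H (Suc n))" for n
  proof -
    note [measurable] = x_meas[of "Suc n"] lift[OF x_meas[of n]] lift[OF y_meas[of n]] w_meas[of n]
    show ?thesis unfolding V_def by measurable
  qed
  have d_meas: "d n \<in> borel_measurable (H (Suc (Suc n)))" for n
  proof -
    note [measurable] = x_meas[of "Suc (Suc n)"] lift[OF x_meas[of "Suc n"]]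
      lift[OF y_meas[of "Suc n"]] w_meas[of "Suc n"]
    show ?thesis unfolding d_def by measurable
  qed
  have sq: "square_integrable M (\<lambda>\<omega>. x n \<omega> - xs)" "square_integrable M (\<lambda>\<omega>. y n \<omega> - xs)"
    "square_integrable M (\<lambda>\<omega>. x m \<omega> - y n \<omega>)" for m n
    by (intro square_integrable_diff square_integrable_const x_sq y_sq)+
  have V_int: "integrable M (V n)" for n
    unfolding V_def
    by (intro Bochner_Integration.integrable_add integrable_mult_right square_integrableD(2)
        integrable_inner_const sq w_sq)
  have d_int: "integrable M (d n)" for n
    unfolding d_def
    by (intro Bochner_Integration.integrable_add integrable_mult_right square_integrableD(2)
        integrable_inner_const sq w_sq)
  have pointwise: "V (Suc n) \<omega> + d n \<omega> \<le> V n \<omega> - (7/8) * (norm (x (Suc n) \<omega> - x n \<omega>))\<^sup>2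
      - 2 * \<gamma> * (w (Suc n) \<omega> \<bullet> (y (Suc n) \<omega> - xs)) + 12 * \<gamma>\<^sup>2 * (norm (w (Suc n) \<omega>))\<^sup>2" for n \<omega>
    using reflected_gradient_step[OF X lip mono VI_solD(1)[OF xs] x_in x_step y_step x_step \<gamma>, of n \<omega>]
    unfolding V_def d_def by linarith
  have absorb: "V n \<omega> - (7/8) * (norm (x (Suc n) \<omega> - x n \<omega>))\<^sup>2
      + 12 * \<gamma>\<^sup>2 * ((\<nu>1\<^sup>2 * (norm (y (Suc n) \<omega>))\<^sup>2 + \<nu>2\<^sup>2) / real (N (Suc n))) \<le> (1 + b n) * V n \<omega> + c n" for n \<omega>
  proof -
    define p q where "p = (norm (x (Suc n) \<omega> - x n \<omega>))\<^sup>2" and "q = (norm (x (Suc n) \<omega> - xs))\<^sup>2"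
    define r where "r = 1 / real (N (Suc n))"
    have r: "0 \<le> r" "64 * \<gamma>\<^sup>2 * \<nu>1\<^sup>2 * r \<le> 1"
      using N(1)[of "Suc n"] N(2)[of "Suc n"] by (auto simp: r_def field_simps)
    have "(norm (y (Suc n) \<omega>))\<^sup>2 \<le> 2 * (norm (y (Suc n) \<omega> - xs))\<^sup>2 + 2 * (norm xs)\<^sup>2"
      using norm_add_sq_le[of "y (Suc n) \<omega> - xs" xs] by simp
    moreover have "(norm (y (Suc n) \<omega> - xs))\<^sup>2 \<le> 2 * q + 2 * p"
      using norm_add_sq_le[of "x (Suc n) \<omega> - xs" "x (Suc n) \<omega> - x n \<omega>"]
      unfolding y_step p_def q_def by (simp add: algebra_simps scaleR_2)
    ultimately have "(norm (y (Suc n) \<omega>))\<^sup>2 \<le> 4 * q + 4 * p + 2 * (norm xs)\<^sup>2" by linarith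
    then have "(12 * \<gamma>\<^sup>2 * r * \<nu>1\<^sup>2) * (norm (y (Suc n) \<omega>))\<^sup>2
        \<le> (12 * \<gamma>\<^sup>2 * r * \<nu>1\<^sup>2) * (4 * q + 4 * p + 2 * (norm xs)\<^sup>2)"
      using r(1) by (intro mult_left_mono) auto
    then have 1: "12 * \<gamma>\<^sup>2 * ((\<nu>1\<^sup>2 * (norm (y (Suc n) \<omega>))\<^sup>2 + \<nu>2\<^sup>2) / real (N (Suc n)))
        \<le> b n * q + (48 * \<gamma>\<^sup>2 * \<nu>1\<^sup>2 * r) * p + c n"
      unfolding b_def c_def r_def[symmetric] divide_inverse[of _ "real (N (Suc n))"]
      using r_def by (simp add: inverse_eq_divide[symmetric] algebra_simps)
    \<comment> \<open>By \<open>r(2)\<close> the factor is at most 48/64, within the 7/8 that the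
      step estimate offers.\<close>
    have 2: "(48 * \<gamma>\<^sup>2 * \<nu>1\<^sup>2 * r) * p \<le> (7/8) * p"
      using r(2) by (intro mult_right_mono) (auto simp: p_def)
    have "q \<le> V n \<omega>" unfolding V_def q_def using a_nn[of n \<omega>] \<gamma>(1) by simp
    then have 3: "b n * q \<le> b n * V n \<omega>" by (intro mult_left_mono) (auto simp: b_def)
    show ?thesis using 1 2 3 unfolding p_def[symmetric] by (simp add: algebra_simps)
  qed
  have "AE \<omega> in M. convergent (\<lambda>n. V n \<omega>) \<and> summable (\<lambda>n. d n \<omega>)"
  \<comment> \<open>\<open>V n\<close> contains \<open>w n\<close>, whose samples are drawn after
    \<open>H n\<close>, so the filtration starts at \<open>H (Suc n)\<close>.\<close>
  proof (rule Robbins_Siegmund[where H = "\<lambda>n. H (Suc n)" and b = b and c = c])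
    fix n A assume A: "A \<in> sets (H (Suc n))"
    then have AM: "A \<in> sets M" using sub[of "Suc n"] by (auto simp: subalgebra_def)
    have si: "set_integrable M A f" if "integrable M f" for f :: "'a \<Rightarrow> real"
      using integrable_mult_indicator[OF AM that] by (simp add: set_integrable_def)
    let ?u = "\<lambda>\<omega>. V n \<omega> - (7/8) * (norm (x (Suc n) \<omega> - x n \<omega>))\<^sup>2"
    let ?m = "\<lambda>\<omega>. w (Suc n) \<omega> \<bullet> (y (Suc n) \<omega> - xs)"
    let ?v = "\<lambda>\<omega>. (norm (w (Suc n) \<omega>))\<^sup>2"
    let ?s = "\<lambda>\<omega>. (\<nu>1\<^sup>2 * (norm (y (Suc n) \<omega>))\<^sup>2 + \<nu>2\<^sup>2) / real (N (Suc n))"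
    have u: "integrable M ?u"
      by (intro Bochner_Integration.integrable_diff integrable_mult_right V_int square_integrableD(2)
          square_integrable_diff x_sq)
    have m: "integrable M ?m" by (intro integrable_inner w_sq sq)
    have v: "integrable M ?v" by (intro square_integrableD(2) w_sq)
    have s: "integrable M ?s" using square_integrableD(2)[OF y_sq[of "Suc n"]] by simp
    have s': "integrable M (\<lambda>\<omega>. 12 * \<gamma>\<^sup>2 * ?s \<omega>)" by (rule integrable_mult_right) (use s in blast)
    have "(LINT \<omega>:A|M. V (Suc n) \<omega> + d n \<omega>) \<le> (LINT \<omega>:A|M. ?u \<omega> - 2 * \<gamma> * ?m \<omega> + 12 * \<gamma>\<^sup>2 * ?v \<omega>)"
      by (rule set_integral_mono) (use V_int d_int u m v pointwise in \<open>auto intro!: si\<close>)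
    also have "\<dots> = (LINT \<omega>:A|M. ?u \<omega>) - 2 * \<gamma> * (LINT \<omega>:A|M. ?m \<omega>) + 12 * \<gamma>\<^sup>2 * (LINT \<omega>:A|M. ?v \<omega>)"
      using u m v by (simp add: set_integral_add set_integral_diff si)
    \<comment> \<open>The martingale difference: \<open>A\<close> and \<open>y (Suc n)\<close> are
      determined before \<open>w (Suc n)\<close> is drawn, so the indicator times
      \<open>y (Suc n) - xs\<close> is an admissible test in \<open>mean\<close>.\<close>
    also have "(LINT \<omega>:A|M. ?m \<omega>) = 0"
    proof -
      have "(LINT \<omega>:A|M. ?m \<omega>) = (LINT \<omega>|M. w (Suc n) \<omega> \<bullet> (indicat_real A \<omega> *\<^sub>R (y (Suc n) \<omega> - xs)))"
        by (simp add: set_lebesgue_integral_def)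
      also have "\<dots> = 0"
      proof (rule mean)
        show "(\<lambda>\<omega>. indicat_real A \<omega> *\<^sub>R (y (Suc n) \<omega> - xs)) \<in> borel_measurable (H (Suc n))"
          using y_meas[of "Suc n"] A by simp
      qed (intro square_integrable_indicator sq AM)
      finally show ?thesis .
    qed
    also have "(LINT \<omega>:A|M. ?u \<omega>) - 2 * \<gamma> * 0 + 12 * \<gamma>\<^sup>2 * (LINT \<omega>:A|M. ?v \<omega>)
        \<le> (LINT \<omega>:A|M. ?u \<omega>) + 12 * \<gamma>\<^sup>2 * (LINT \<omega>:A|M. ?s \<omega>)"
      using mult_left_mono[OF var[OF A], of "12 * \<gamma>\<^sup>2"] by simp
    also have "\<dots> = (LINT \<omega>:A|M. ?u \<omega> + 12 * \<gamma>\<^sup>2 * ?s \<omega>)"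
      using u s' by (subst set_integral_add(2)) (auto intro!: si)
    also have "\<dots> \<le> (LINT \<omega>:A|M. (1 + b n) * V n \<omega> + c n)"
      using absorb by (intro set_integral_mono) (use V_int u s' in \<open>auto intro!: si\<close>)
    finally show "(LINT \<omega>:A|M. V (Suc n) \<omega> + d n \<omega>) \<le> (LINT \<omega>:A|M. (1 + b n) * V n \<omega> + c n)" .
  next
    show "0 \<le> V n \<omega>" "0 \<le> d n \<omega>" for n \<omega>
      using a_nn[of n \<omega>] a_nn[of "Suc n" \<omega>] \<gamma>(1) by (simp_all add: V_def d_def)
    show "summable b" "summable c"
      unfolding b_def c_def by (intro summable_mult N(3))+
    show "sets (H (Suc n)) \<subseteq> sets (H (Suc (Suc n)))" for n by (rule H_mono)
  qed (auto simp: b_def c_def intro: sub V_meas V_int d_meas d_int)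
  then show ?thesis
  proof eventually_elim
    case (elim \<omega>)
    then have d0: "(\<lambda>n. d n \<omega>) \<longlonglongrightarrow> 0" by (simp add: summable_LIMSEQ_zero)
    have small: "e \<longlonglongrightarrow> 0" if "\<And>n. 0 \<le> e n" "\<And>n. k * e n \<le> d n \<omega>" "0 < k" for e k
    proof (rule tendsto_sandwich[OF _ _ tendsto_const])
      show "\<forall>\<^sub>F n in sequentially. e n \<le> d n \<omega> / k"
        using that(2,3) by (simp add: pos_le_divide_eq mult.commute)
      show "(\<lambda>n. d n \<omega> / k) \<longlonglongrightarrow> 0" using tendsto_divide[OF d0 tendsto_const[of k]] that(3) by simp
    qed (use that in auto)
    have a0: "(\<lambda>n. F xs \<bullet> (x (Suc n) \<omega> - xs)) \<longlonglongrightarrow> 0"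
      by (rule small[of _ "2 * \<gamma>"]) (use a_nn \<gamma>(1) in \<open>auto simp: d_def\<close>)
    then have a: "(\<lambda>n. F xs \<bullet> (x n \<omega> - xs)) \<longlonglongrightarrow> 0"
      by (simp only: filterlim_sequentially_Suc[of "\<lambda>n. F xs \<bullet> (x n \<omega> - xs)"])
    have "(\<lambda>n. (norm (x (Suc (Suc n)) \<omega> - y (Suc n) \<omega>))\<^sup>2) \<longlonglongrightarrow> 0"
      by (rule small[of _ "1/8"]) (use a_nn \<gamma>(1) in \<open>auto simp: d_def\<close>)
    then have q: "(\<lambda>n. (norm (x (Suc n) \<omega> - y n \<omega>))\<^sup>2) \<longlonglongrightarrow> 0"
      by (simp only: filterlim_sequentially_Suc[of "\<lambda>n. (norm (x (Suc n) \<omega> - y n \<omega>))\<^sup>2"])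
    have "(\<lambda>n. (norm (w (Suc n) \<omega>))\<^sup>2) \<longlonglongrightarrow> 0"
      by (rule small[of _ "4 * \<gamma>\<^sup>2"]) (use a_nn \<gamma>(1) in \<open>auto simp: d_def\<close>)
    then have w: "(\<lambda>n. (norm (w n \<omega>))\<^sup>2) \<longlonglongrightarrow> 0"
      by (simp only: filterlim_sequentially_Suc[of "\<lambda>n. (norm (w n \<omega>))\<^sup>2"])
    obtain l where "(\<lambda>n. V n \<omega>) \<longlonglongrightarrow> l" using elim by (auto simp: convergent_def)
    then have "(\<lambda>n. sqrt (V n \<omega> - (1/8) * (norm (x (Suc n) \<omega> - y n \<omega>))\<^sup>2
        - 2 * \<gamma> * (F xs \<bullet> (x n \<omega> - xs)) - 4 * \<gamma>\<^sup>2 * (norm (w n \<omega>))\<^sup>2))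
        \<longlonglongrightarrow> sqrt (l - (1/8) * 0 - 2 * \<gamma> * 0 - 4 * \<gamma>\<^sup>2 * 0)"
      by (intro tendsto_intros a q w)
    then have "(\<lambda>n. norm (x (Suc n) \<omega> - xs)) \<longlonglongrightarrow> sqrt l" by (simp add: V_def)
    then have "(\<lambda>n. norm (x n \<omega> - xs)) \<longlonglongrightarrow> sqrt l"
      by (simp only: filterlim_sequentially_Suc[of "\<lambda>n. norm (x n \<omega> - xs)"])
    then show ?case using a by (auto simp: convergent_def)
  qed
qed

text \<open>Cross terms vanish by conditional orthogonality, so the second moment grows with the
  number of samples and not with its square; this yields the factor 1/N_k for the average.
  Coordinates are treated separately because \<open>real_cond_exp\<close> is scalar, and the
  indicator of \<open>A\<close> is absorbed into the first factor.\<close>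

lemma (in prob_space) integral_norm_sum_sq_le:
  fixes e :: "'i \<Rightarrow> 'a \<Rightarrow> 'b::euclidean_space"
  assumes sub: "subalgebra M H" and fin: "finite I"
    and Z: "\<And>i. i \<in> I \<Longrightarrow> Z i \<in> measurable M S"
    and indep: "\<And>i j B C. i \<in> I \<Longrightarrow> j \<in> I \<Longrightarrow> i \<noteq> j \<Longrightarrow> B \<in> sets S \<Longrightarrow> C \<in> sets S \<Longrightarrow>
      AE \<omega> in M. real_cond_exp M H (\<lambda>\<omega>. indicator B (Z i \<omega>) * indicator C (Z j \<omega>)) \<omega>
        = real_cond_exp M H (\<lambda>\<omega>. indicator B (Z i \<omega>)) \<omega> * real_cond_exp M H (\<lambda>\<omega>. indicator C (Z j \<omega>)) \<omega>"
    and e_meas: "\<And>i. i \<in> I \<Longrightarrow> e i \<in> borel_measurable (enlarge H S (Z i))"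
    and e_sq: "\<And>i. i \<in> I \<Longrightarrow> square_integrable M (e i)"
    and e_mean: "\<And>i b. i \<in> I \<Longrightarrow> b \<in> Basis \<Longrightarrow> AE \<omega> in M. real_cond_exp M H (\<lambda>\<omega>. e i \<omega> \<bullet> b) \<omega> = 0"
    and A: "A \<in> sets H"
    and bound: "\<And>i. i \<in> I \<Longrightarrow> (LINT \<omega>:A|M. (norm (e i \<omega>))\<^sup>2) \<le> K"
  shows "(LINT \<omega>:A|M. (norm (\<Sum>i\<in>I. e i \<omega>))\<^sup>2) \<le> real (card I) * K"
proof -
  have AM: "A \<in> sets M" using A sub by (auto simp: subalgebra_def)
  have sp: "space H = space M" using sub by (simp add: subalgebra_def)
  have ZH: "Z i \<in> space H \<rightarrow> space S" if "i \<in> I" for i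
    using measurable_space[OF Z[OF that]] sp by auto
  have comp_int: "integrable M (\<lambda>\<omega>. indicat_real A \<omega> * (e i \<omega> \<bullet> b) * (e j \<omega> \<bullet> b))"
    if "i \<in> I" "j \<in> I" "b \<in> Basis" for i j b
  proof -
    have "integrable M (\<lambda>\<omega>. (indicat_real A \<omega> *\<^sub>R (e i \<omega> \<bullet> b)) \<bullet> (e j \<omega> \<bullet> b))"
      by (intro integrable_inner square_integrable_indicator square_integrable_component e_sq that AM)
    then show ?thesis by simp
  qed
  have orth: "(LINT \<omega>|M. indicat_real A \<omega> * (e i \<omega> \<bullet> e j \<omega>)) = 0" if "i \<in> I" "j \<in> I" "i \<noteq> j" for i j
  proof -
    have "(LINT \<omega>|M. indicat_real A \<omega> * (e i \<omega> \<bullet> e j \<omega>))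
        = (LINT \<omega>|M. (\<Sum>b\<in>Basis. indicat_real A \<omega> * (e i \<omega> \<bullet> b) * (e j \<omega> \<bullet> b)))"
      by (subst euclidean_inner) (simp add: sum_distrib_left mult.assoc)
    also have "\<dots> = (\<Sum>b\<in>Basis. LINT \<omega>|M. (indicat_real A \<omega> * (e i \<omega> \<bullet> b)) * (e j \<omega> \<bullet> b))"
      by (rule Bochner_Integration.integral_sum) (intro comp_int that)
    also have "\<dots> = (\<Sum>b\<in>(Basis::'b set). 0)"
    proof (rule sum.cong[OF refl])
      fix b :: 'b assume b: "b \<in> Basis"
      show "(LINT \<omega>|M. (indicat_real A \<omega> * (e i \<omega> \<bullet> b)) * (e j \<omega> \<bullet> b)) = 0"
      proof (rule cond_indep_imp_orthogonal[OF sub Z[OF that(1)] Z[OF that(2)] indep[OF that]])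
        show "(\<lambda>\<omega>. indicat_real A \<omega> * (e i \<omega> \<bullet> b)) \<in> borel_measurable (enlarge H S (Z i))"
          using e_meas[OF that(1)] measurable_enlarge1[OF ZH[OF that(1)], of "indicat_real A" borel] A by simp
        show "(\<lambda>\<omega>. e j \<omega> \<bullet> b) \<in> borel_measurable (enlarge H S (Z j))"
          using e_meas[OF that(2)] by simp
        have "integrable M (\<lambda>\<omega>. 1 \<bullet> (e j \<omega> \<bullet> b))"
          by (intro integrable_inner_const square_integrable_component e_sq that b)
        then show "integrable M (\<lambda>\<omega>. e j \<omega> \<bullet> b)" by simp
      qed (intro comp_int e_mean that b | assumption)+
    qed
    finally show ?thesis by simp
  qed
  have ij_int: "integrable M (\<lambda>\<omega>. indicat_real A \<omega> * (e i \<omega> \<bullet> e j \<omega>))" if "i \<in> I" "j \<in> I" for i j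
  proof -
    have "integrable M (\<lambda>\<omega>. (indicat_real A \<omega> *\<^sub>R e i \<omega>) \<bullet> e j \<omega>)"
      by (intro integrable_inner square_integrable_indicator e_sq that AM)
    then show ?thesis by simp
  qed
  have "(LINT \<omega>:A|M. (norm (\<Sum>i\<in>I. e i \<omega>))\<^sup>2)
      = (LINT \<omega>|M. (\<Sum>i\<in>I. \<Sum>j\<in>I. indicat_real A \<omega> * (e i \<omega> \<bullet> e j \<omega>)))"
    unfolding set_lebesgue_integral_def
  proof (rule Bochner_Integration.integral_cong[OF refl])
    show "indicat_real A \<omega> *\<^sub>R (norm (\<Sum>i\<in>I. e i \<omega>))\<^sup>2
        = (\<Sum>i\<in>I. \<Sum>j\<in>I. indicat_real A \<omega> * (e i \<omega> \<bullet> e j \<omega>))" for \<omega>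
      by (simp add: power2_norm_eq_inner inner_sum_left inner_sum_right sum_distrib_left) (rule sum.swap)
  qed
  also have "\<dots> = (\<Sum>i\<in>I. \<Sum>j\<in>I. LINT \<omega>|M. indicat_real A \<omega> * (e i \<omega> \<bullet> e j \<omega>))"
    using ij_int by simp
  also have "\<dots> = (\<Sum>i\<in>I. \<Sum>j\<in>I. if j = i then (LINT \<omega>:A|M. (norm (e i \<omega>))\<^sup>2) else 0)"
    by (intro sum.cong refl) (simp add: orth set_lebesgue_integral_def power2_norm_eq_inner)
  also have "\<dots> = (\<Sum>i\<in>I. LINT \<omega>:A|M. (norm (e i \<omega>))\<^sup>2)"
    using fin by simp
  also have "\<dots> \<le> (\<Sum>i\<in>I. K)" by (intro sum_mono bound)
  finally show ?thesis by simp
qed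

section \<open>The sample history and conditional moments\<close>

lemma sets_hist:
  "sets (hist M S N \<xi> k) = sigma_sets (space M)
     (\<Union>i\<in>{..<k}. \<Union>j\<in>{..<N i}. {\<xi> j i -` B \<inter> space M | B. B \<in> sets S})"
  unfolding hist_def by (rule sets_measure_of) auto

lemma space_hist: "space (hist M S N \<xi> k) = space M"
  unfolding hist_def by (rule space_measure_of_conv)

lemma subalgebra_hist:
  assumes "\<And>j k. \<xi> j k \<in> measurable M S"
  shows "subalgebra M (hist M S N \<xi> k)"
proof -
  have "(\<Union>i\<in>{..<k}. \<Union>j\<in>{..<N i}. {\<xi> j i -` B \<inter> space M | B. B \<in> sets S}) \<subseteq> sets M"
    using measurable_sets[OF assms] by auto
  then show ?thesis
    unfolding subalgebra_def sets_hist space_hist by (simp add: sets.sigma_sets_subset)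
qed

lemma hist_mono: "sets (hist M S N \<xi> k) \<subseteq> sets (hist M S N \<xi> (Suc k))"
  unfolding sets_hist by (intro sigma_sets_mono' UN_mono) auto

lemma measurable_hist:
  assumes "\<xi> j i \<in> measurable M S" "i < k" "j < N i"
  shows "\<xi> j i \<in> measurable (hist M S N \<xi> k) S"
proof (rule measurableI)
  show "\<xi> j i \<omega> \<in> space S" if "\<omega> \<in> space (hist M S N \<xi> k)" for \<omega>
    using measurable_space[OF assms(1)] that by (simp add: space_hist)
  show "\<xi> j i -` B \<inter> space (hist M S N \<xi> k) \<in> sets (hist M S N \<xi> k)" if "B \<in> sets S" for B
    unfolding sets_hist space_hist using that assms by (intro sigma_sets.Basic) blast
qed

lemma measurable_hist_Suc: "f \<in> measurable (hist M S N \<xi> k) T \<Longrightarrow> f \<in> measurable (hist M S N \<xi> (Suc k)) T"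
  using hist_mono[of M S N \<xi> k] by (auto simp: measurable_def space_hist)

text \<open>Integrability of \<open>f\<close> is a conclusion, hence \<open>nn_cond_exp\<close>: an
  infinite conditional expectation would slip through a bound on \<open>real_cond_exp\<close>, which
  turns it into 0.\<close>

lemma (in finite_measure) nn_cond_exp_le_imp_integral_le:
  fixes f g :: "'a \<Rightarrow> real"
  assumes sub: "subalgebra M H" and f: "f \<in> borel_measurable M" "\<And>\<omega>. 0 \<le> f \<omega>"
    and g: "integrable M g" "\<And>\<omega>. 0 \<le> g \<omega>"
    and le: "AE \<omega> in M. nn_cond_exp M H (\<lambda>\<omega>. ennreal (f \<omega>)) \<omega> \<le> ennreal (g \<omega>)"
  shows "integrable M f" and "A \<in> sets H \<Longrightarrow> (LINT \<omega>:A|M. f \<omega>) \<le> (LINT \<omega>:A|M. g \<omega>)"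
proof -
  interpret H: finite_measure_subalgebra M H by unfold_locales (rule sub)
  note [measurable] = f(1)
  have HM: "B \<in> sets M" if "B \<in> sets H" for B using that sub by (auto simp: subalgebra_def)
  have gi: "integrable M (\<lambda>\<omega>. indicat_real B \<omega> * g \<omega>)" if "B \<in> sets H" for B
    using integrable_mult_indicator[OF HM[OF that] g(1)] by simp
  have key: "(\<integral>\<^sup>+\<omega>. ennreal (indicat_real B \<omega> * f \<omega>) \<partial>M) \<le> ennreal (LINT \<omega>:B|M. g \<omega>)"
    if B: "B \<in> sets H" for B
  proof -
    have "(\<integral>\<^sup>+\<omega>. ennreal (indicat_real B \<omega> * f \<omega>) \<partial>M) = (\<integral>\<^sup>+\<omega>. indicator B \<omega> * ennreal (f \<omega>) \<partial>M)"
      by (intro nn_integral_cong) (simp add: indicator_def)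
    also have "\<dots> = (\<integral>\<^sup>+\<omega>. indicator B \<omega> * nn_cond_exp M H (\<lambda>\<omega>. ennreal (f \<omega>)) \<omega> \<partial>M)"
      by (rule H.nn_cond_exp_intg[symmetric]) (use B in auto)
    also have "\<dots> \<le> (\<integral>\<^sup>+\<omega>. ennreal (indicat_real B \<omega> * g \<omega>) \<partial>M)"
    proof (rule nn_integral_mono_AE)
      show "AE \<omega> in M. indicator B \<omega> * nn_cond_exp M H (\<lambda>\<omega>. ennreal (f \<omega>)) \<omega> \<le> ennreal (indicat_real B \<omega> * g \<omega>)"
        using le by eventually_elim (auto simp: indicator_def)
    qed
    also have "\<dots> = ennreal (LINT \<omega>:B|M. g \<omega>)"
      unfolding set_lebesgue_integral_def real_scaleR_def
      by (rule nn_integral_eq_integral[OF gi[OF B]])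
        (intro AE_I2 mult_nonneg_nonneg indicator_pos_le g(2))
    finally show ?thesis .
  qed
  have "(\<integral>\<^sup>+\<omega>. ennreal (f \<omega>) \<partial>M) \<le> ennreal (LINT \<omega>:space M|M. g \<omega>)"
  proof -
    have "space M \<in> sets H" using sets.top[of H] sub unfolding subalgebra_def by metis
    moreover have "(\<integral>\<^sup>+\<omega>. ennreal (f \<omega>) \<partial>M) = (\<integral>\<^sup>+\<omega>. ennreal (indicat_real (space M) \<omega> * f \<omega>) \<partial>M)"
      by (intro nn_integral_cong) simp
    ultimately show ?thesis using key[of "space M"] by simp
  qed
  then show fi: "integrable M f"
    by (intro integrableI_nonneg) (auto simp: f(2) less_top[symmetric] top_unique)
  assume A: "A \<in> sets H"
  have "ennreal (LINT \<omega>:A|M. f \<omega>) = (\<integral>\<^sup>+\<omega>. ennreal (indicat_real A \<omega> * f \<omega>) \<partial>M)"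
    unfolding set_lebesgue_integral_def real_scaleR_def
    using integrable_mult_indicator[OF HM[OF A] fi]
    by (intro nn_integral_eq_integral[symmetric] AE_I2 mult_nonneg_nonneg indicator_pos_le f(2)) simp
  also have "\<dots> \<le> ennreal (LINT \<omega>:A|M. g \<omega>)" by (rule key[OF A])
  finally have "ennreal (LINT \<omega>:A|M. f \<omega>) \<le> ennreal (LINT \<omega>:A|M. g \<omega>)" .
  moreover have "0 \<le> (LINT \<omega>:A|M. g \<omega>)"
    unfolding set_lebesgue_integral_def real_scaleR_def
    by (intro Bochner_Integration.integral_nonneg mult_nonneg_nonneg indicator_pos_le g(2))
  ultimately show "(LINT \<omega>:A|M. f \<omega>) \<le> (LINT \<omega>:A|M. g \<omega>)" by simp
qed

text \<open>Taking out what is known, coordinate by coordinate; square integrability of both factors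
  makes each product integrable.\<close>

lemma (in finite_measure) integral_inner_cond_mean_zero:
  fixes e f :: "'a \<Rightarrow> 'b::euclidean_space"
  assumes sub: "subalgebra M H" and e: "square_integrable M e"
    and mean: "\<And>b. b \<in> Basis \<Longrightarrow> AE \<omega> in M. real_cond_exp M H (\<lambda>\<omega>. e \<omega> \<bullet> b) \<omega> = 0"
    and f: "f \<in> borel_measurable H" "square_integrable M f"
  shows "(LINT \<omega>|M. e \<omega> \<bullet> f \<omega>) = 0"
proof -
  interpret H: finite_measure_subalgebra M H by unfold_locales (rule sub)
  have int: "integrable M (\<lambda>\<omega>. (f \<omega> \<bullet> b) * (e \<omega> \<bullet> b))" if "b \<in> Basis" for b
    using integrable_inner[OF square_integrable_component[OF f(2) that] square_integrable_component[OF e that]]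
    by simp
  have "(LINT \<omega>|M. e \<omega> \<bullet> f \<omega>) = (LINT \<omega>|M. (\<Sum>b\<in>Basis. (f \<omega> \<bullet> b) * (e \<omega> \<bullet> b)))"
    by (subst euclidean_inner) (simp add: mult.commute)
  also have "\<dots> = (\<Sum>b\<in>Basis. LINT \<omega>|M. (f \<omega> \<bullet> b) * (e \<omega> \<bullet> b))"
    by (rule Bochner_Integration.integral_sum) (rule int)
  also have "\<dots> = (\<Sum>b\<in>(Basis::'b set). 0)"
  proof (rule sum.cong[OF refl])
    fix b :: 'b assume b: "b \<in> Basis"
    have fH: "(\<lambda>\<omega>. f \<omega> \<bullet> b) \<in> borel_measurable H" using f(1) by simp
    have eM: "(\<lambda>\<omega>. e \<omega> \<bullet> b) \<in> borel_measurable M" using square_integrableD(1)[OF e] by simp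
    have "(LINT \<omega>|M. (f \<omega> \<bullet> b) * (e \<omega> \<bullet> b))
        = (LINT \<omega>|M. (f \<omega> \<bullet> b) * real_cond_exp M H (\<lambda>\<omega>. e \<omega> \<bullet> b) \<omega>)"
      by (rule H.real_cond_exp_intg(2)[symmetric, OF int[OF b] fH eM])
    also have "\<dots> = (LINT \<omega>|M. 0)"
      using mean[OF b] measurable_from_subalg[OF sub fH]
      by (intro integral_cong_AE) (auto elim!: eventually_mono)
    finally show "(LINT \<omega>|M. (f \<omega> \<bullet> b) * (e \<omega> \<bullet> b)) = 0" by simp
  qed
  finally show ?thesis by simp
qed

theorem theorem1:
  fixes M :: "'w measure" and S :: "'c measure"
    and X :: "'a::euclidean_space set"
    and F :: "'a \<Rightarrow> 'a" and G :: "'a \<Rightarrow> 'c \<Rightarrow> 'a"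
    and \<xi> :: "nat \<Rightarrow> nat \<Rightarrow> 'w \<Rightarrow> 'c"
    and N :: "nat \<Rightarrow> nat"
    and L C \<alpha> \<nu>1 \<nu>2 \<gamma> :: real
    and xm1 x0 :: 'a
  assumes prob: "prob_space M"
    and X_ne: "X \<noteq> {}" and X_closed: "closed X" and X_convex: "convex X"
    and G_meas: "(\<lambda>(x, c). G x c) \<in> borel_measurable (borel \<Otimes>\<^sub>M S)"
    and \<xi>_meas: "\<And>j k. \<xi> j k \<in> M \<rightarrow>\<^sub>M S"
    and A1_lip: "L-lipschitz_on UNIV F" and A1_mono: "monotone_op F"
    and A2_ne: "VI_sol X F \<noteq> {}" and A2_compact: "compact (VI_sol X F)"
    and A2_C: "C > 0" and A2_bound: "\<And>xs. xs \<in> VI_sol X F \<Longrightarrow> norm (F xs) \<le> C"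
    and A3_pos: "\<alpha> > 0"
    and A3: "\<And>x xs. x \<in> X \<Longrightarrow> xs \<in> VI_sol X F \<Longrightarrow> (x - xs) \<bullet> F xs \<ge> \<alpha> * infdist x (VI_sol X F)"
    and A4_nu: "\<nu>1 \<ge> 0" "\<nu>2 \<ge> 0"
    and A4_int: "\<And>j k. j < N k \<Longrightarrow> integrable M (\<lambda>\<omega>.
          G (2 *\<^sub>R vsprg X G \<gamma> N \<xi> xm1 x0 (Suc k) \<omega> - vsprg X G \<gamma> N \<xi> xm1 x0 k \<omega>) (\<xi> j k \<omega>)
        - F (2 *\<^sub>R vsprg X G \<gamma> N \<xi> xm1 x0 (Suc k) \<omega> - vsprg X G \<gamma> N \<xi> xm1 x0 k \<omega>))"
    and A4_mean: "\<And>j k b. j < N k \<Longrightarrow> b \<in> Basis \<Longrightarrow> AE \<omega> in M.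
        real_cond_exp M (hist M S N \<xi> k) (\<lambda>\<omega>.
          (G (2 *\<^sub>R vsprg X G \<gamma> N \<xi> xm1 x0 (Suc k) \<omega> - vsprg X G \<gamma> N \<xi> xm1 x0 k \<omega>) (\<xi> j k \<omega>)
          - F (2 *\<^sub>R vsprg X G \<gamma> N \<xi> xm1 x0 (Suc k) \<omega> - vsprg X G \<gamma> N \<xi> xm1 x0 k \<omega>)) \<bullet> b) \<omega> = 0"
    and A4_var: "\<And>j k. j < N k \<Longrightarrow> AE \<omega> in M.
        nn_cond_exp M (hist M S N \<xi> k) (\<lambda>\<omega>. ennreal ((norm
          (G (2 *\<^sub>R vsprg X G \<gamma> N \<xi> xm1 x0 (Suc k) \<omega> - vsprg X G \<gamma> N \<xi> xm1 x0 k \<omega>) (\<xi> j k \<omega>)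
          - F (2 *\<^sub>R vsprg X G \<gamma> N \<xi> xm1 x0 (Suc k) \<omega> - vsprg X G \<gamma> N \<xi> xm1 x0 k \<omega>)))\<^sup>2)) \<omega>
        \<le> ennreal (\<nu>1\<^sup>2 * (norm (2 *\<^sub>R vsprg X G \<gamma> N \<xi> xm1 x0 (Suc k) \<omega> - vsprg X G \<gamma> N \<xi> xm1 x0 k \<omega>))\<^sup>2
                   + \<nu>2\<^sup>2)"
    and A4_indep: "\<And>k J B. J \<subseteq> {..<N k} \<Longrightarrow> (\<And>j. j \<in> J \<Longrightarrow> B j \<in> sets S) \<Longrightarrow> AE \<omega> in M.
        real_cond_exp M (hist M S N \<xi> k) (\<lambda>\<omega>. \<Prod>j\<in>J. indicator (B j) (\<xi> j k \<omega>)) \<omega>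
        = (\<Prod>j\<in>J. real_cond_exp M (hist M S N \<xi> k) (\<lambda>\<omega>. indicator (B j) (\<xi> j k \<omega>)) \<omega>)"
    and N_pos: "\<And>k. N k \<ge> 1" and N_mono: "mono N"
    and N_sum: "\<exists>Mb. summable (\<lambda>k. 1 / real (N (Suc k))) \<and> (\<Sum>k. 1 / real (N (Suc k))) < Mb"
    and \<gamma>_pos: "\<gamma> > 0"
    and \<gamma>_le: "8 * \<gamma> * sqrt (L\<^sup>2 + 10 * \<nu>1\<^sup>2 / real (N 0)) \<le> 1"
    and x0_in: "x0 \<in> X"
  shows "AE \<omega> in M. \<exists>xs \<in> VI_sol X F.
           (\<lambda>k. vsprg X G \<gamma> N \<xi> xm1 x0 (Suc k) \<omega>) \<longlonglongrightarrow> xs"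
proof -
  interpret prob_space M by (rule prob)
  define H where "H = hist M S N \<xi>"
  define v where "v = vsprg X G \<gamma> N \<xi> xm1 x0"
  \<comment> \<open>\<open>v\<close> starts at x_{-1}. The shift makes \<open>x 0\<close> equal to
    \<open>x0\<close>, so that all \<open>x n\<close> lie in \<open>X\<close>, which
    \<open>v 0\<close> need not.\<close>
  define x where "x n = v (Suc n)" for n
  define y where "y n \<omega> = 2 *\<^sub>R v (Suc n) \<omega> - v n \<omega>" for n \<omega>
  define e where "e n j \<omega> = G (y n \<omega>) (\<xi> j n \<omega>) - F (y n \<omega>)" for n j \<omega>
  define w where "w n \<omega> = (1 / real (N n)) *\<^sub>R (\<Sum>j<N n. e n j \<omega>)" for n \<omega>
  note defs = e_def y_def v_def H_def
  have N0: "0 < real (N n)" for n using N_pos[of n] by simp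
  have sub: "subalgebra M (H n)" for n unfolding H_def by (rule subalgebra_hist) (rule \<xi>_meas)
  have sp: "space (H n) = space M" for n using sub by (simp add: subalgebra_def)

  have lipF: "continuous_on UNIV F" by (rule lipschitz_on_continuous_on[OF A1_lip])
  have F_meas [measurable]: "F \<in> borel_measurable borel"
    by (rule borel_measurable_continuous_onI[OF lipF])
  note lipP = lipschitz_closest_point[OF X_convex X_closed X_ne]
  have P_meas [measurable]: "closest_point X \<in> borel_measurable borel"
    by (rule borel_measurable_continuous_onI[OF lipschitz_on_continuous_on[OF lipP]])

  have v_Suc: "v (Suc (Suc n)) \<omega> = closest_point X (v (Suc n) \<omega> - \<gamma> *\<^sub>R (F (y n \<omega>) + w n \<omega>))" for n \<omega>
  proof -
    have "(\<gamma> / real (N n)) *\<^sub>R (\<Sum>j<N n. G (y n \<omega>) (\<xi> j n \<omega>)) = \<gamma> *\<^sub>R (F (y n \<omega>) + w n \<omega>)"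
      using N0[of n] by (simp add: w_def e_def sum_subtractf scaleR_right_diff_distrib scaleR_right_distrib sum_constant_scaleR)
    then show ?thesis by (simp add: v_def y_def Let_def)
  qed
  have x_step: "x (Suc n) \<omega> = closest_point X (x n \<omega> - \<gamma> *\<^sub>R (F (y n \<omega>) + w n \<omega>))" for n \<omega>
    unfolding x_def by (rule v_Suc)
  have y_step: "y (Suc n) \<omega> = 2 *\<^sub>R x (Suc n) \<omega> - x n \<omega>" for n \<omega> by (simp add: x_def y_def)
  have v0: "v 0 = (\<lambda>_. xm1)" "v (Suc 0) = (\<lambda>_. x0)" by (simp_all add: v_def fun_eq_iff)
  have x_in: "x n \<omega> \<in> X" for n \<omega>
    by (cases n) (simp_all add: x_step closest_point_in_set X_closed X_ne, simp add: x_def v0 x0_in)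

  \<comment> \<open>\<open>K\<close> is left free because this serves for the next history, for
    \<open>M\<close>, and for the join of the history with a single sample.\<close>
  have e_gen: "e n j \<in> borel_measurable K"
    if [measurable]: "y n \<in> borel_measurable K" "\<xi> j n \<in> measurable K S" for n j K
  proof -
    have "(\<lambda>\<omega>. (\<lambda>(x, c). G x c) (y n \<omega>, \<xi> j n \<omega>)) \<in> borel_measurable K"
      by (rule measurable_compose[OF _ G_meas]) measurable
    then have [measurable]: "(\<lambda>\<omega>. G (y n \<omega>) (\<xi> j n \<omega>)) \<in> borel_measurable K" by simp
    show ?thesis unfolding e_def by measurable
  qed
  \<comment> \<open>Two consecutive iterates at once, since \<open>y n\<close> depends on
    both.\<close>
  have v_meas: "v n \<in> borel_measurable (H n) \<and> v (Suc n) \<in> borel_measurable (H n)" for n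
  proof (induction n)
    case 0
    show ?case by (simp add: v0)
  next
    case (Suc n)
    have [measurable]: "v n \<in> borel_measurable (H (Suc n))" "v (Suc n) \<in> borel_measurable (H (Suc n))"
      using Suc measurable_hist_Suc unfolding H_def by blast+
    have [measurable]: "y n \<in> borel_measurable (H (Suc n))" unfolding y_def by measurable
    have [measurable]: "e n j \<in> borel_measurable (H (Suc n))" if "j < N n" for j
      unfolding H_def by (rule e_gen[OF _ measurable_hist[OF \<xi>_meas]])
        (use \<open>y n \<in> _\<close> that in \<open>auto simp: H_def\<close>)
    have [measurable]: "w n \<in> borel_measurable (H (Suc n))" unfolding w_def by measurable
    have "v (Suc (Suc n)) \<in> borel_measurable (H (Suc n))" unfolding v_Suc[abs_def] by measurable
    then show ?case by simp
  qed
  have x_meas: "x n \<in> borel_measurable (H n)" for n using v_meas by (simp add: x_def)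
  have y_meas: "y n \<in> borel_measurable (H n)" for n
    using v_meas[of n] unfolding y_def by (intro borel_measurable_diff borel_measurable_scaleR) auto
  have y_measM: "y n \<in> borel_measurable M" for n by (rule measurable_from_subalg[OF sub y_meas])
  have e_measM: "e n j \<in> borel_measurable M" for n j
    by (rule e_gen[OF y_measM \<xi>_meas])
  have e_enl: "e n j \<in> borel_measurable (enlarge (H n) S (\<xi> j n))" for n j
  proof -
    have "\<xi> j n \<in> space (H n) \<rightarrow> space S" using measurable_space[OF \<xi>_meas] sp by auto
    then show ?thesis by (intro e_gen measurable_enlarge1 measurable_enlarge2 y_meas)
  qed
  have w_meas: "w n \<in> borel_measurable (H (Suc n))" for n
  proof -
    have "e n j \<in> borel_measurable (H (Suc n))" if "j < N n" for j
      unfolding H_def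
      by (rule e_gen[OF _ measurable_hist[OF \<xi>_meas]])
        (use measurable_hist_Suc y_meas[of n] that in \<open>auto simp: H_def\<close>)
    then show ?thesis unfolding w_def by (intro borel_measurable_scaleR borel_measurable_sum) auto
  qed

  have e_mean: "AE \<omega> in M. real_cond_exp M (H n) (\<lambda>\<omega>. e n j \<omega> \<bullet> b) \<omega> = 0"
    if "j < N n" "b \<in> Basis" for n j b
    using A4_mean[OF that] unfolding defs .
  have e_var: "AE \<omega> in M. nn_cond_exp M (H n) (\<lambda>\<omega>. ennreal ((norm (e n j \<omega>))\<^sup>2)) \<omega>
      \<le> ennreal (\<nu>1\<^sup>2 * (norm (y n \<omega>))\<^sup>2 + \<nu>2\<^sup>2)" if "j < N n" for n j
    using A4_var[OF that] unfolding defs .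
  have var_int: "integrable M (\<lambda>\<omega>. \<nu>1\<^sup>2 * (norm (y n \<omega>))\<^sup>2 + \<nu>2\<^sup>2)" if "square_integrable M (y n)" for n
    using square_integrableD(2)[OF that] by simp
  have norm_e_meas: "(\<lambda>\<omega>. (norm (e n j \<omega>))\<^sup>2) \<in> borel_measurable M" for n j
    using e_measM[of n j] by simp
  have e_sq': "square_integrable M (e n j)" if "square_integrable M (y n)" "j < N n" for n j
    unfolding square_integrable_def
    by (intro conjI e_measM nn_cond_exp_le_imp_integral_le(1)[OF sub norm_e_meas _ var_int[OF that(1)] _ e_var[OF that(2)]])
      auto
  have w_sq': "square_integrable M (w n)" if "square_integrable M (y n)" for n
    unfolding w_def by (intro square_integrable_scaleR square_integrable_sum e_sq' that) auto
  \<comment> \<open>The variance bound is only as good as the second moment of \<open>y n\<close>,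
    so square integrability is gained along the iteration: from \<open>y n\<close> to the errors,
    from these to the next iterate.\<close>
  have v_sq: "square_integrable M (v n) \<and> square_integrable M (v (Suc n))" for n
  proof (induction n)
    case 0
    show ?case by (simp add: v0 square_integrable_const)
  next
    case (Suc n)
    then have "square_integrable M (y n)"
      unfolding y_def by (intro square_integrable_diff square_integrable_scaleR) auto
    then have "square_integrable M (v (Suc (Suc n)))"
      unfolding v_Suc[abs_def]
      by (intro square_integrable_lipschitz[OF lipP] square_integrable_diff square_integrable_scaleR
          square_integrable_add square_integrable_lipschitz[OF A1_lip] w_sq' Suc[THEN conjunct2])
    then show ?case using Suc by simp
  qed
  have x_sq: "square_integrable M (x n)" for n using v_sq by (simp add: x_def)
  have y_sq: "square_integrable M (y n)" for n
    unfolding y_def using v_sq[of n] by (intro square_integrable_diff square_integrable_scaleR) auto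
  note e_sq = e_sq'[OF y_sq] and w_sq = w_sq'[OF y_sq]

  have mean: "(LINT \<omega>|M. w n \<omega> \<bullet> f \<omega>) = 0"
    if f: "f \<in> borel_measurable (H n)" "square_integrable M f" for n f
  proof -
    have "(LINT \<omega>|M. w n \<omega> \<bullet> f \<omega>) = (LINT \<omega>|M. (1 / real (N n)) * (\<Sum>j<N n. e n j \<omega> \<bullet> f \<omega>))"
      by (simp add: w_def inner_sum_left)
    also have "\<dots> = (1 / real (N n)) * (\<Sum>j<N n. LINT \<omega>|M. e n j \<omega> \<bullet> f \<omega>)"
      by (subst integral_mult_right_zero, subst Bochner_Integration.integral_sum)
        (auto intro: integrable_inner e_sq f)
    also have "\<dots> = 0"
      by (simp add: integral_inner_cond_mean_zero[OF sub e_sq e_mean f])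
    finally show ?thesis .
  qed
  have var: "(LINT \<omega>:A|M. (norm (w n \<omega>))\<^sup>2)
      \<le> (LINT \<omega>:A|M. (\<nu>1\<^sup>2 * (norm (y n \<omega>))\<^sup>2 + \<nu>2\<^sup>2) / real (N n))" if A: "A \<in> sets (H n)" for n A
  proof -
    let ?K = "LINT \<omega>:A|M. \<nu>1\<^sup>2 * (norm (y n \<omega>))\<^sup>2 + \<nu>2\<^sup>2"
    have "(LINT \<omega>:A|M. (norm (\<Sum>j\<in>{..<N n}. e n j \<omega>))\<^sup>2) \<le> real (card {..<N n}) * ?K"
    proof (rule integral_norm_sum_sq_le[OF sub, where Z = "\<lambda>j. \<xi> j n" and S = S])
      fix i j B C assume ij: "i \<in> {..<N n}" "j \<in> {..<N n}" "i \<noteq> j" and "B \<in> sets S" "C \<in> sets S"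
      then show "AE \<omega> in M. real_cond_exp M (H n) (\<lambda>\<omega>. indicator B (\<xi> i n \<omega>) * indicator C (\<xi> j n \<omega>)) \<omega>
          = real_cond_exp M (H n) (\<lambda>\<omega>. indicator B (\<xi> i n \<omega>)) \<omega>
            * real_cond_exp M (H n) (\<lambda>\<omega>. indicator C (\<xi> j n \<omega>)) \<omega>"
        using A4_indep[of "{i, j}" n "\<lambda>m. if m = i then B else C"] by (simp add: H_def)
    next
      fix j assume "j \<in> {..<N n}"
      then show "(LINT \<omega>:A|M. (norm (e n j \<omega>))\<^sup>2) \<le> ?K"
        by (intro nn_cond_exp_le_imp_integral_le(2)[OF sub norm_e_meas _ var_int[OF y_sq] _ e_var A]) auto
    qed (use A e_enl e_sq e_mean \<xi>_meas in auto)
    \<comment> \<open>Averaging contributes the factor 1/N_n squared and the batch a factor N_n,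
      leaving 1/N_n.\<close>
    then have "(1 / real (N n))\<^sup>2 * (LINT \<omega>:A|M. (norm (\<Sum>j\<in>{..<N n}. e n j \<omega>))\<^sup>2)
        \<le> (1 / real (N n))\<^sup>2 * (real (N n) * ?K)"
      by (intro mult_left_mono) auto
    moreover have "(LINT \<omega>:A|M. (norm (w n \<omega>))\<^sup>2)
        = (1 / real (N n))\<^sup>2 * (LINT \<omega>:A|M. (norm (\<Sum>j\<in>{..<N n}. e n j \<omega>))\<^sup>2)"
      by (simp add: w_def power_mult_distrib power_divide flip: set_integral_mult_right)
    moreover have "(LINT \<omega>:A|M. (\<nu>1\<^sup>2 * (norm (y n \<omega>))\<^sup>2 + \<nu>2\<^sup>2) / real (N n)) = (1 / real (N n)) * ?K"
      by (simp flip: set_integral_mult_right)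
    ultimately show ?thesis using N0[of n] by (simp add: power2_eq_square)
  qed

  have L: "0 \<le> L" by (rule lipschitz_on_nonneg[OF A1_lip])
  have "L \<le> sqrt (L\<^sup>2 + 10 * \<nu>1\<^sup>2 / real (N 0))" by (rule real_le_rsqrt) simp
  then have "8 * \<gamma> * L \<le> 8 * \<gamma> * sqrt (L\<^sup>2 + 10 * \<nu>1\<^sup>2 / real (N 0))"
    using \<gamma>_pos by (intro mult_left_mono) auto
  with \<gamma>_le have \<gamma>L: "8 * \<gamma> * L \<le> 1" by linarith
  \<comment> \<open>The noise summand under the root in the steplength bound gives this at index 0,
    and monotonicity of \<open>N\<close> carries it to every \<open>n\<close>.\<close>
  have \<gamma>N: "64 * \<gamma>\<^sup>2 * \<nu>1\<^sup>2 \<le> real (N n)" for n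
  proof -
    have "(8 * \<gamma> * sqrt (L\<^sup>2 + 10 * \<nu>1\<^sup>2 / real (N 0)))\<^sup>2 \<le> 1"
      using \<gamma>_pos \<gamma>_le by (intro power_le_one) auto
    then have "64 * \<gamma>\<^sup>2 * (L\<^sup>2 + 10 * \<nu>1\<^sup>2 / real (N 0)) \<le> 1"
      by (simp add: power_mult_distrib)
    moreover have "64 * \<gamma>\<^sup>2 * (\<nu>1\<^sup>2 / real (N 0)) \<le> 64 * \<gamma>\<^sup>2 * (L\<^sup>2 + 10 * \<nu>1\<^sup>2 / real (N 0))"
      by (intro mult_left_mono add_increasing) (auto intro: divide_right_mono)
    ultimately have "64 * \<gamma>\<^sup>2 * (\<nu>1\<^sup>2 / real (N 0)) \<le> 1" by linarith
    then have "64 * \<gamma>\<^sup>2 * \<nu>1\<^sup>2 \<le> real (N 0)" using N0[of 0] by (simp add: field_simps)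
    also have "\<dots> \<le> real (N n)" using monoD[OF N_mono, of 0 n] by simp
    finally show ?thesis .
  qed

  \<comment> \<open>The null set on which the Lyapunov argument fails depends on \<open>xs\<close>,
    so it may be collected over countably many solutions only.\<close>
  obtain D where D: "countable D" "D \<subseteq> VI_sol X F" "VI_sol X F \<subseteq> closure D"
    using separable by blast
  have "AE \<omega> in M. convergent (\<lambda>n. norm (x n \<omega> - xs)) \<and> (\<lambda>n. F xs \<bullet> (x n \<omega> - xs)) \<longlonglongrightarrow> 0"
    if "xs \<in> VI_sol X F" for xs
  proof (rule noisy_reflected_gradient_Fejer[where H = H])
    show "sets (H n) \<subseteq> sets (H (Suc n))" for n unfolding H_def by (rule hist_mono)
    show "summable (\<lambda>n. 1 / real (N (Suc n)))" using N_sum by blast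
  qed (fact sub X_closed X_convex A1_lip A1_mono that \<gamma>_pos \<gamma>L N_pos \<gamma>N x_in x_step y_step
      x_meas y_meas w_meas x_sq y_sq w_sq mean var)+
  then have "AE \<omega> in M. \<forall>xs\<in>D. convergent (\<lambda>n. norm (x n \<omega> - xs)) \<and> (\<lambda>n. F xs \<bullet> (x n \<omega> - xs)) \<longlonglongrightarrow> 0"
    using D by (subst AE_ball_countable) auto
  then show ?thesis
  proof eventually_elim
    case (elim \<omega>)
    have "D \<noteq> {}" using D(3) A2_ne by auto
    \<comment> \<open>Weak sharpness at a single solution bounds the distance to the whole solution
      set.\<close>
    then obtain xs where xs: "xs \<in> D" by blast
    have "(\<lambda>n. infdist (x n \<omega>) (VI_sol X F)) \<longlonglongrightarrow> 0"
    proof (rule tendsto_sandwich[OF _ _ tendsto_const])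
      have "infdist (x n \<omega>) (VI_sol X F) \<le> (F xs \<bullet> (x n \<omega> - xs)) / \<alpha>" for n
        using A3[OF x_in, of xs n \<omega>] xs D(2) A3_pos
        by (auto simp: pos_le_divide_eq inner_commute mult.commute)
      then show "\<forall>\<^sub>F n in sequentially. infdist (x n \<omega>) (VI_sol X F) \<le> (F xs \<bullet> (x n \<omega> - xs)) / \<alpha>"
        by simp
      show "(\<lambda>n. (F xs \<bullet> (x n \<omega> - xs)) / \<alpha>) \<longlonglongrightarrow> 0"
        using elim xs by (intro tendsto_divide_zero) blast
    qed (simp add: infdist_nonneg)
    then have "\<exists>p\<in>VI_sol X F. (\<lambda>n. x n \<omega>) \<longlonglongrightarrow> p"
      by (intro Fejer_convergent[OF A2_compact A2_ne D(2,3)]) (use elim in auto)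
    then show ?case by (simp add: x_def v_def)
  qed
qed

end
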